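(* Let $W$ be a positive word over $\{\sigma_1,\sigma_2\}$ and let $p\ge 0$ be an integer. Suppose that the braid $X=W\Delta^{-p}\in\mathbf{B}_3$ is quasipositive. Then every orbit of the Hurwitz action on quasipositive factorizations of $X$ contains an element of the form $W_I$ with $W$-minimal $I$.
   Context: $\mathbf{B}_3=\langle\sigma_1,\sigma_2\mid\sigma_1\sigma_2\sigma_1=\sigma_2\sigma_1\sigma_2\rangle$ is the group of braids with three strings, and $\Delta=\sigma_1\sigma_2\sigma_1$. A quasipositive factorization of $X\in\mathbf{B}_3$ is a tuple $(X_1,\dots,X_k)\in\mathbf{B}_3^k$ such that $X_1\cdots X_k=X$ and each $X_i$ is conjugate in $\mathbf{B}_3$ to $\sigma_1$. A braid is quasipositive if it admits at least one quasipositive factorization. For a group $G$ and $1\le i<k$, define $\Sigma_i:G^k\to G^k$ by $\Sigma_i(X_1,\dots,X_k)=(Y_1,\dots,Y_k)$ where $(Y_i,Y_{i+1})=(X_iX_{i+1}X_i^{-1},X_i)$ and $Y_j=X_j$ for $j\notin\{i,i+1\}$. These maps are invertible, and $\sigma_i\mapsto\Sigma_i$ defines an action of the braid group $\mathbf{B}_k$ on $G^k$, called the Hurwitz action. With $G=\mathbf{B}_3$ it preserves the set of quasipositive factorizations (of length $k$) of a given braid. A positive word is a word over the alphabet $\{\sigma_1,\sigma_2\}$ (no inverses); a word also denotes the braid it represents. $\equiv$ denotes letterwise coincidence of words, and $=$ denotes equality in $\mathbf{B}_3$. Let $W\equiv a_1\dots a_n$ be such a word and $I=\{i_1,\dots,i_k\}$,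 $1\le i_1<\dots<i_k\le n$. Put $x_j=a_{i_j}$, $i_0=0$, $i_{k+1}=n+1$, and let $W_j\equiv a_l\dots a_m$ with $l=i_{j-1}+1$, $m=i_j-1$ ($1\le j\le k+1$), so that $W\equiv W_1x_1W_2x_2\cdots W_kx_kW_{k+1}$. Put $A_j=W_1\cdots W_j$. Define the word $W\setminus I\equiv W_1\cdots W_{k+1}$ and the tuple $W_I=(A_1x_1A_1^{-1},\dots,A_kx_kA_k^{-1})\in\mathbf{B}_3^k$. ($W_I$ is a quasipositive factorization of $W\Delta^{-p}$ if and only if $W\setminus I=\Delta^p$ in $\mathbf{B}_3$.) $I$ is called $W$-minimal if there is no $i$ such that $i-1\ge 1$, $i-1\notin I$, $i\in I$, and $a_{i-1}=a_i$ (as letters). *)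

theory Defs
  imports Main
begin

section \<open>The braid group on three strings\<close>

datatype gen = S1 | S2

text \<open>
  In a signed word the letter \<open>(a, True)\<close> stands for the generator \<open>a\<close> and \<open>(a, False)\<close>
  for its inverse.
\<close>

inductive braid_step :: "(gen \<times> bool) list \<Rightarrow> (gen \<times> bool) list \<Rightarrow> bool" where
  cancel: "braid_step (u @ [(a, e), (a, \<not> e)] @ v) (u @ v)"
| braid: "braid_step (u @ [(S1, True), (S2, True), (S1, True)] @ v)
                     (u @ [(S2, True), (S1, True), (S2, True)] @ v)"

abbreviation braid_eq :: "(gen \<times> bool) list \<Rightarrow> (gen \<times> bool) list \<Rightarrow> bool" where
  "braid_eq \<equiv> equivclp braid_step"

quotient_type braid3 = "(gen \<times> bool) list" / "equivclp braid_step"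
  by (rule equivp_evquivclp)

lemma braid_step_context:
  assumes "braid_step x y"
  shows "braid_step (u @ x @ v) (u @ y @ v)"
  using assms
proof cases
  case (cancel u' a e v')
  then show ?thesis using braid_step.cancel[of "u @ u'" a e "v' @ v"] by simp
next
  case (braid u' v')
  then show ?thesis using braid_step.braid[of "u @ u'" "v' @ v"] by simp
qed

lemma braid_eq_context:
  assumes "braid_eq x y"
  shows "braid_eq (u @ x @ v) (u @ y @ v)"
  using assms
  by (induction rule: equivclp_induct)
    (auto intro: braid_step_context equivclp_into_equivclp)

lemma braid_eq_append:
  assumes "braid_eq x y" "braid_eq u v"
  shows "braid_eq (x @ u) (y @ v)"
proof -
  have "braid_eq (x @ u) (y @ u)"
    using braid_eq_context[OF assms(1), of "[]" u] by simp
  also have "braid_eq (y @ u) (y @ v)"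
    using braid_eq_context[OF assms(2), of y "[]"] by simp
  finally (equivclp_trans) show ?thesis .
qed

definition word_inv :: "(gen \<times> bool) list \<Rightarrow> (gen \<times> bool) list" where
  "word_inv w = rev (map (\<lambda>(a, e). (a, \<not> e)) w)"

lemma word_inv_left: "braid_eq (word_inv w @ w) []"
proof (induction w)
  case (Cons p w)
  obtain a e where p: "p = (a, e)" by (cases p)
  have "braid_step (word_inv (p # w) @ (p # w)) (word_inv w @ w)"
    using braid_step.cancel[of "word_inv w" a "\<not> e" w] by (simp add: p word_inv_def)
  then show ?case using Cons.IH by (metis r_into_equivclp equivclp_trans)
qed (simp add: word_inv_def)

lemma word_inv_right: "braid_eq (w @ word_inv w) []"
proof -
  have "word_inv (word_inv w) = w"
    by (simp add: word_inv_def rev_map o_def case_prod_unfold)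
  then show ?thesis using word_inv_left[of "word_inv w"] by simp
qed

lemma word_inv_cong:
  assumes "braid_eq x y"
  shows "braid_eq (word_inv x) (word_inv y)"
proof -
  have "braid_eq (word_inv x @ y @ word_inv y) (word_inv x)"
    using braid_eq_context[OF word_inv_right[of y], of "word_inv x" "[]"] by simp
  moreover have "braid_eq (word_inv x @ x @ word_inv y) (word_inv x @ y @ word_inv y)"
    by (rule braid_eq_context[OF assms])
  moreover have "braid_eq (word_inv x @ x @ word_inv y) (word_inv y)"
    using braid_eq_append[OF word_inv_left[of x] equivclp_refl[of _ "word_inv y"]] by simp
  ultimately show ?thesis by (meson equivclp_sym equivclp_trans)
qed

instantiation braid3 :: "{monoid_mult, inverse}"
begin

lift_definition one_braid3 :: braid3 is "[]" .

lift_definition times_braid3 :: "braid3 \<Rightarrow> braid3 \<Rightarrow> braid3" is "(@)"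
  by (rule braid_eq_append)

lift_definition inverse_braid3 :: "braid3 \<Rightarrow> braid3" is word_inv
  by (rule word_inv_cong)

definition divide_braid3 :: "braid3 \<Rightarrow> braid3 \<Rightarrow> braid3" where
  "divide_braid3 x y = x * inverse y"

instance
  by standard (transfer; simp)+

end

global_interpretation braid3: group times "1 :: braid3" inverse
  by standard (transfer; simp add: word_inv_left)+

lift_definition sigma :: "gen \<Rightarrow> braid3" is "\<lambda>a. [(a, True)]" .

lemma braid_relation:
  "sigma S1 * sigma S2 * sigma S1 = sigma S2 * sigma S1 * sigma S2"
  by transfer (use braid_step.braid[of "[]" "[]"] in \<open>simp add: r_into_equivclp\<close>)

definition Delta :: braid3 where
  "Delta = sigma S1 * sigma S2 * sigma S1"

text \<open>Positive words have type \<^typ>\<open>gen list\<close>.\<close>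

definition braid_of :: "gen list \<Rightarrow> braid3" where
  "braid_of w = prod_list (map sigma w)"

section \<open>Quasipositive factorizations\<close>

definition conjugate :: "'a::{monoid_mult,inverse} \<Rightarrow> 'a \<Rightarrow> bool" where
  "conjugate x y \<longleftrightarrow> (\<exists>g. x = g * y * inverse g)"

text \<open>Tuples are lists; the length \<open>k\<close> is arbitrary, including \<open>k = 0\<close>.\<close>

definition qp_factorization :: "braid3 \<Rightarrow> braid3 list \<Rightarrow> bool" where
  "qp_factorization X Xs \<longleftrightarrow> prod_list Xs = X \<and> (\<forall>Y \<in> set Xs. conjugate Y (sigma S1))"

definition quasipositive :: "braid3 \<Rightarrow> bool" where
  "quasipositive X \<longleftrightarrow> (\<exists>Xs. qp_factorization X Xs)"

section \<open>The Hurwitz action\<close>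

text \<open>
  The index \<open>i\<close> is counted from 1 and list positions from 0, so the \<open>i\<close>-th and \<open>(i+1)\<close>-st
  entries of \<open>Xs\<close> are \<open>Xs ! (i - 1)\<close> and \<open>Xs ! i\<close>.  The maps are meaningful only for
  \<open>1 \<le> i < length Xs\<close>.
\<close>

definition hurwitz :: "nat \<Rightarrow> 'a::{monoid_mult,inverse} list \<Rightarrow> 'a list" where
  "hurwitz i Xs =
     Xs[i - 1 := Xs ! (i - 1) * Xs ! i * inverse (Xs ! (i - 1)), i := Xs ! (i - 1)]"

definition hurwitz_inv :: "nat \<Rightarrow> 'a::{monoid_mult,inverse} list \<Rightarrow> 'a list" where
  "hurwitz_inv i Xs =
     Xs[i - 1 := Xs ! i, i := inverse (Xs ! i) * Xs ! (i - 1) * Xs ! i]"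

lemma hurwitz_inverse:
  fixes Xs :: "braid3 list"
  assumes "1 \<le> i" "i < length Xs"
  shows "hurwitz_inv i (hurwitz i Xs) = Xs" "hurwitz i (hurwitz_inv i Xs) = Xs"
proof -
  have cancel: "inverse x * (x * y) = y" "x * (inverse x * y) = y" for x y :: braid3
    by (simp_all flip: mult.assoc)
  show "hurwitz_inv i (hurwitz i Xs) = Xs" "hurwitz i (hurwitz_inv i Xs) = Xs"
    using assms
    by (auto simp: hurwitz_def hurwitz_inv_def nth_list_update mult.assoc cancel
        intro!: nth_equalityI)
qed

text \<open>
  An element of the braid group on \<open>k\<close> strings is represented by a word in its generators
  and their inverses, here pairs \<open>(i, e)\<close> with \<open>1 \<le> i < k\<close>, and it acts by composing the
  corresponding maps.  The orbit of a tuple is the set of its images under all these words.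
\<close>

definition hurwitz_act :: "(nat \<times> bool) list \<Rightarrow> 'a::{monoid_mult,inverse} list \<Rightarrow> 'a list" where
  "hurwitz_act b Xs = foldr (\<lambda>(i, e). if e then hurwitz i else hurwitz_inv i) b Xs"

definition hurwitz_orbit :: "'a::{monoid_mult,inverse} list \<Rightarrow> 'a list set" where
  "hurwitz_orbit Xs = {hurwitz_act b Xs | b. \<forall>(i, e) \<in> set b. 1 \<le> i \<and> i < length Xs}"

section \<open>The factorizations read off from a positive word\<close>

text \<open>
  As in the usual notation \<open>W = a\<^sub>1 \<dots> a\<^sub>n\<close>, letters are numbered from 1, and \<open>I\<close> is a
  subset of \<open>{1..n}\<close>.  For \<open>I = {i\<^sub>1 < \<dots> < i\<^sub>k}\<close>, the value of \<open>cut W I j\<close> is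
  \<open>i\<^sub>j\<close>, including the conventions \<open>i\<^sub>0 = 0\<close> and \<open>i\<^bsub>k+1\<^esub> = n + 1\<close>.
\<close>

definition letter :: "gen list \<Rightarrow> nat \<Rightarrow> gen" where
  "letter W i = W ! (i - 1)"

definition cut :: "gen list \<Rightarrow> nat set \<Rightarrow> nat \<Rightarrow> nat" where
  "cut W I j = (0 # sorted_list_of_set I @ [length W + 1]) ! j"

text \<open>The word \<open>W\<^sub>j\<close> strictly between the positions \<open>i\<^bsub>j-1\<^esub>\<close> and \<open>i\<^sub>j\<close>, for \<open>1 \<le> j \<le> k + 1\<close>:\<close>

definition gap :: "gen list \<Rightarrow> nat set \<Rightarrow> nat \<Rightarrow> gen list" where
  "gap W I j = map (letter W) [cut W I (j - 1) + 1 ..< cut W I j]"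

text \<open>The word \<open>A\<^sub>j = W\<^sub>1 \<dots> W\<^sub>j\<close>:\<close>

definition gaps_upto :: "gen list \<Rightarrow> nat set \<Rightarrow> nat \<Rightarrow> gen list" where
  "gaps_upto W I j = concat (map (gap W I) [1..<j + 1])"

text \<open>The tuple \<open>W\<^sub>I\<close>:\<close>

definition word_tuple :: "gen list \<Rightarrow> nat set \<Rightarrow> braid3 list" where
  "word_tuple W I =
     map (\<lambda>j. braid_of (gaps_upto W I j) * sigma (letter W (cut W I j))
                * inverse (braid_of (gaps_upto W I j)))
       [1..<card I + 1]"

definition minimal :: "gen list \<Rightarrow> nat set \<Rightarrow> bool" where
  "minimal W I \<longleftrightarrow>
     \<not> (\<exists>i. i - 1 \<ge> 1 \<and> i - 1 \<notin> I \<and> i \<in> I \<and> letter W (i - 1) = letter W i)"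

end

theory Submission
  imports Defs
begin

text \<open>
  Below, \<open>a\<close> and \<open>b\<close> are the two letters, in either order, and a letter in parentheses is
  selected.  The remainder of a positive word with selected letters is what is left when these
  are deleted.  Deleting the selected letters one at a time splits off one conjugate of a generator
  at each step, and deleting one further letter lengthens the tuple, up to Hurwitz moves, by the
  conjugate that this deletion splits off (\<open>select_one_more\<close>).  That conjugate is
  determined by the braids before and after the deletion.  Hence the choice of the letter is
  immaterial: two deletions that lead to the same braid give Hurwitz equivalent tuples
  (\<open>swap_selected\<close>).

  Every tuple of conjugates of \<open>\<sigma>\<^sub>1\<close> comes from some word with selected letters.  Indeed
  \<open>\<Delta>\<^sup>2\<close> is central and every braid becomes positive when multiplied by a power of it, so
  \<open>g \<sigma>\<^sub>1 g\<^sup>-\<^sup>1\<close> is obtained from a word \<open>G (\<sigma>\<^sub>1) H\<close> in which \<open>G\<close>, \<open>H\<close> represent \<open>g\<close>,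
  \<open>g\<^sup>-\<^sup>1\<close> up to such powers.  Given a factorization of \<open>W \<Delta>\<^sup>-\<^sup>p\<close>, this produces a
  positive word \<open>V\<close> that equals \<open>W \<Delta>\<^sup>2\<^sup>n\<close> in the group, and whose remainder is
  \<open>\<Delta>\<^sup>2\<^sup>n\<^sup>+\<^sup>p\<close>.  It remains to carry the selection over from \<open>V\<close> to the word
  \<open>W \<Delta>\<^sup>2\<^sup>n\<close> and then from there to \<open>W\<close>.

  Positive words that are equal in the group are connected by moves \<open>a b a \<rightarrow> b a b\<close>, as the
  normal form \<open>\<Delta>\<^sup>k w\<close> shows (\<open>braid_moves_connect\<close>).  Under such a move the
  selection can be adapted directly, unless exactly the middle letter of \<open>a b a\<close> is
  selected: the remainder of the triple is then \<open>a a\<close>, which no selection in \<open>b a b\<close>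
  leaves.  Here it matters that the whole remainder \<open>R a a S\<close> is a power of \<open>\<Delta>\<close>:
  instead of the inserted \<open>b\<close> one can delete a letter of \<open>R\<close> or of \<open>S\<close>
  (\<open>replace_between_equal\<close>).  The reason is that a nonempty word for a power of \<open>\<Delta>\<close>
  contains \<open>a b a\<close> or \<open>b a b\<close>.  If that triple is disjoint from the square, it can be
  pulled out as a factor \<open>\<Delta>\<close>, and induction applies.  If it meets the square, then the square
  lies in \<open>a a b a\<close> or \<open>a b a a\<close>, and \<open>a a b a = a b a b\<close> gives the letter, since this is
  \<open>a (b) a b a\<close> with the last \<open>a\<close> deleted in place of \<open>b\<close>.

  A similar exchange frees the letters of a final \<open>\<Delta>\<close> from the selection one after the
  other (\<open>replace_near_end\<close>), so that this \<open>\<Delta>\<close> can be cancelled both in the word and in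
  its remainder.  Finally, \<open>a (a)\<close> and \<open>(a) a\<close> give the same tuple, so a selection with
  the least sum of positions is minimal.
\<close>

section \<open>Normal forms in the braid group\<close>

fun other :: "gen \<Rightarrow> gen" where
  "other S1 = S2"
| "other S2 = S1"

lemma other_other [simp]: "other (other c) = c"
  by (cases c) auto

lemma other_neq [simp]: "other c \<noteq> c" "c \<noteq> other c"
  by (cases c; simp)+

lemma neq_imp_other: "x \<noteq> c \<Longrightarrow> x = other c"
  by (cases c; cases x) auto

fun delta_free :: "gen list \<Rightarrow> bool" where
  "delta_free (x # y # z # w) \<longleftrightarrow> \<not> (y = other x \<and> z = x) \<and> delta_free (y # z # w)"
| "delta_free w \<longleftrightarrow> True"

text \<open>
  A pair \<open>(k, w)\<close> with \<open>w\<close> free of \<open>a b a\<close> and \<open>b a b\<close> stands for \<open>\<Delta>\<^sup>k w\<close>, and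
  \<open>lmul c\<close> is left multiplication by the generator \<open>c\<close>.  On its way past \<open>\<Delta>\<^sup>k\<close> the letter
  \<open>c\<close> becomes \<open>d\<close>, and if this completes a triple, then the triple is a further \<open>\<Delta>\<close>.
\<close>

fun lmul :: "gen \<Rightarrow> int \<times> gen list \<Rightarrow> int \<times> gen list" where
  "lmul c (k, w) =
     (let d = (if even k then c else other c)
      in if take 2 w = [other d, d] then (k + 1, drop 2 w) else (k, d # w))"

lemma delta_free_tl: "delta_free (x # w) \<Longrightarrow> delta_free w"
  by (cases "x # w" rule: delta_free.cases) auto

lemma delta_free_drop: "delta_free w \<Longrightarrow> delta_free (drop n w)"
proof (induction n arbitrary: w)
  case (Suc n)
  then show ?case by (cases w) (auto dest: delta_free_tl)
qed simp

lemma delta_free_lmul: "delta_free (snd s) \<Longrightarrow> delta_free (snd (lmul c s))"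
proof (cases s)
  case (Pair k w)
  assume "delta_free (snd s)"
  then show ?thesis
    using delta_free_drop[of w 2]
    by (cases w rule: delta_free.cases) (auto simp: Pair Let_def)
qed

lemma word_cases3:
  obtains "w = []" | x where "w = [x]" | x y where "w = [x, y]" | x y z v where "w = x # y # z # v"
  by (metis neq_Nil_conv)

text \<open>
  This is the braid relation for the action on normal forms: both sides of it act by raising the
  exponent of \<open>\<Delta>\<close>.  Since that is a bijection, it also makes each \<open>lmul c\<close> invertible.
\<close>

lemma lmul_delta:
  assumes "delta_free w"
  shows "lmul c (lmul (other c) (lmul c (k, w))) = (k + 1, w)"
  using assms
proof (cases w rule: word_cases3)
  case (4 x y z v)
  then show ?thesis using assms
    by (cases c; cases x; cases y; cases z; cases "even k")
      (auto simp: Let_def)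
next
  case (3 x y)
  then show ?thesis
    by (cases c; cases x; cases y; cases "even k") (auto simp: Let_def)
next
  case (2 x)
  then show ?thesis
    by (cases c; cases x; cases "even k") (auto simp: Let_def)
qed (simp add: Let_def)

lemma lmul_shift:
  "lmul c (k - 1, w) = (fst (lmul (other c) (k, w)) - 1, snd (lmul (other c) (k, w)))"
  by (auto simp: Let_def)

text \<open>
  Multiplication by \<open>c\<^sup>-\<^sup>1 = c' c \<Delta>\<^sup>-\<^sup>1\<close>, where \<open>c'\<close> is the other generator.
\<close>

definition linv :: "gen \<Rightarrow> int \<times> gen list \<Rightarrow> int \<times> gen list" where
  "linv c s = lmul (other c) (lmul c (fst s - 1, snd s))"

lemma lmul_linv: "delta_free (snd s) \<Longrightarrow> lmul c (linv c s) = s"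
  by (simp add: linv_def lmul_delta del: lmul.simps)

lemma linv_lmul:
  assumes "delta_free (snd s)"
  shows "linv c (lmul c s) = s"
proof -
  obtain k w where s: "s = (k, w)" by (cases s)
  obtain k' w' where s': "lmul c (k, w) = (k', w')" by (cases "lmul c (k, w)")
  have "lmul (other c) (k - 1, w) = (k' - 1, w')"
    using lmul_shift[of "other c" k w] s' by (simp del: lmul.simps)
  then have "linv c (lmul c s) = lmul (other c) (lmul c (lmul (other c) (k - 1, w)))"
    using s s' by (simp add: linv_def del: lmul.simps)
  also have "\<dots> = s"
    using lmul_delta[of w "other c" "k - 1"] assms s by (simp del: lmul.simps)
  finally show ?thesis .
qed

lemma delta_free_linv: "delta_free (snd s) \<Longrightarrow> delta_free (snd (linv c s))"
  by (simp add: linv_def delta_free_lmul del: lmul.simps)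

fun act_letter :: "gen \<times> bool \<Rightarrow> int \<times> gen list \<Rightarrow> int \<times> gen list" where
  "act_letter (c, True) s = lmul c s"
| "act_letter (c, False) s = linv c s"

abbreviation act :: "(gen \<times> bool) list \<Rightarrow> int \<times> gen list \<Rightarrow> int \<times> gen list" where
  "act \<equiv> foldr act_letter"

lemma delta_free_act: "delta_free (snd s) \<Longrightarrow> delta_free (snd (act u s))"
proof (induction u)
  case (Cons p u)
  then show ?case
    by (cases p; cases "snd p")
      (auto simp: delta_free_lmul delta_free_linv simp del: lmul.simps)
qed simp

lemma act_braid_step:
  assumes "braid_step u v" "delta_free (snd s)"
  shows "act u s = act v s"
  using assms(1)
proof cases
  case (cancel u' a e v')
  have "delta_free (snd (act v' s))" using assms(2) by (rule delta_free_act)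
  then show ?thesis
    by (cases e) (simp_all add: cancel lmul_linv linv_lmul del: lmul.simps)
next
  case (braid u' v')
  have "delta_free (snd (act v' s))" using assms(2) by (rule delta_free_act)
  then show ?thesis
    using lmul_delta[of "snd (act v' s)" S1 "fst (act v' s)"]
      lmul_delta[of "snd (act v' s)" S2 "fst (act v' s)"]
    by (simp add: braid del: lmul.simps)
qed

lemma act_braid_eq:
  assumes "braid_eq u v" "delta_free (snd s)"
  shows "act u s = act v s"
  using assms(1)
  by (induction rule: equivclp_induct) (auto dest: act_braid_step[OF _ assms(2)])

text \<open>
  The normal form of a braid is the image of the trivial one under the action of the group.  This
  is how positive words are told apart in the group.
\<close>

lift_definition nf :: "braid3 \<Rightarrow> int \<times> gen list" is "\<lambda>u. act u (0, [])"
  by (rule act_braid_eq) auto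

lemma nf_one [simp]: "nf 1 = (0, [])"
  by transfer simp

lemma nf_sigma_mult: "nf (sigma c * g) = lmul c (nf g)"
  by transfer simp

lemma delta_free_nf: "delta_free (snd (nf g))"
  by transfer (simp add: delta_free_act)

lemma braid_of_simps [simp]:
  "braid_of [] = 1" "braid_of (c # w) = sigma c * braid_of w"
  "braid_of (u @ v) = braid_of u * braid_of v"
  by (simp_all add: braid_of_def)

lemma Delta_eq: "Delta = sigma c * sigma (other c) * sigma c"
  by (cases c) (simp_all add: Delta_def braid_relation)

lemma nf_Delta_mult: "nf (Delta * g) = (fst (nf g) + 1, snd (nf g))"
  unfolding Delta_eq[of S1]
  using lmul_delta[OF delta_free_nf, of S1 "fst (nf g)" g]
  by (simp add: nf_sigma_mult mult.assoc del: lmul.simps)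

lemma nf_Delta_power: "nf (Delta ^ q) = (int q, [])"
  by (induction q) (simp_all add: nf_Delta_mult)

lemma nf_delta_free: "delta_free w \<Longrightarrow> nf (braid_of w) = (0, w)"
proof (induction w)
  case (Cons c w)
  then have "nf (braid_of w) = (0, w)" by (auto dest: delta_free_tl)
  then have "nf (braid_of (c # w)) = lmul c (0, w)"
    by (simp add: nf_sigma_mult del: lmul.simps)
  then show ?case using Cons.prems
    by (cases w rule: word_cases3) (auto simp: Let_def)
qed simp

text \<open>
  A positive word can only raise the exponent.  Together with \<open>nf_Delta_mult\<close> this shows that a
  word that contains \<open>\<Delta>\<close> has a positive exponent.
\<close>

lemma nf_positive_nonneg: "fst (nf (braid_of w)) \<ge> 0"
proof (induction w)
  case (Cons c w)
  then show ?case
    by (cases "nf (braid_of w)") (auto simp: nf_sigma_mult Let_def)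
qed simp

section \<open>Positive words\<close>

lemma Delta_sigma: "sigma c * Delta = Delta * sigma (other c)"
proof -
  have "sigma c * Delta = sigma c * (sigma (other c) * sigma c * sigma (other c))"
    by (subst Delta_eq[of "other c"]) simp
  also have "\<dots> = Delta * sigma (other c)"
    by (subst Delta_eq[of c]) (simp add: mult.assoc)
  finally show ?thesis .
qed

abbreviation flip :: "gen list \<Rightarrow> gen list" where
  "flip \<equiv> map other"

lemma other_comp_other [simp]: "other \<circ> other = id"
  by (simp add: fun_eq_iff)

lemma Delta_braid_of: "Delta * braid_of w = braid_of (flip w) * Delta"
proof (induction w)
  case (Cons c w)
  have "Delta * braid_of (c # w) = sigma (other c) * (Delta * braid_of w)"
    using Delta_sigma[of "other c"] by (simp flip: mult.assoc)
  then show ?case using Cons by (simp add: mult.assoc)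
qed simp

lemma braid_of_Delta: "braid_of w * Delta = Delta * braid_of (flip w)"
  using Delta_braid_of[of "flip w"] by simp

lemma braid_of_insert_Delta:
  "braid_of (K @ [c, other c, c] @ L) = braid_of (K @ flip L) * Delta"
proof -
  have "braid_of (K @ [c, other c, c] @ L) = braid_of K * (Delta * braid_of L)"
    by (simp add: Delta_eq[of c] mult.assoc)
  then show ?thesis by (simp add: Delta_braid_of mult.assoc)
qed

lemma not_delta_free:
  "\<not> delta_free w \<Longrightarrow> \<exists>K c L. w = K @ [c, other c, c] @ L"
proof (induction w rule: delta_free.induct)
  case (1 x y z w)
  show ?case
  proof (cases "y = other x \<and> z = x")
    case True
    then show ?thesis by (intro exI[of _ "[]"]) auto
  next
    case False
    then obtain K c L where "y # z # w = K @ [c, other c, c] @ L"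
      using 1 by auto
    then show ?thesis by (intro exI[of _ "x # K"]) auto
  qed
qed auto

text \<open>
  The form in which the hypothesis \<open>V = \<Delta>\<^sup>q\<close> is used in inductions on \<open>q\<close>.  The normal
  form of a nonempty word without \<open>a b a\<close> and \<open>b a b\<close> is the word itself, so it differs from
  that of \<open>\<Delta>\<^sup>q\<close>; otherwise the triple moves to the right as a factor \<open>\<Delta>\<close>, which
  interchanges the letters that it passes.
\<close>

lemma delta_word_cases:
  assumes "braid_of V = Delta ^ q"
  obtains "q = 0" "V = []"
  | K c L q' where "q = Suc q'" "V = K @ [c, other c, c] @ L"
      "braid_of (K @ flip L) = Delta ^ q'"
proof (cases "delta_free V")
  case True
  then have "(0, V) = (int q, [])"
    using nf_delta_free assms nf_Delta_power by metis
  then show ?thesis using that(1) by simp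
next
  case False
  then obtain K c L where V: "V = K @ [c, other c, c] @ L"
    using not_delta_free by blast
  have "braid_of V = Delta * braid_of (flip (K @ flip L))"
    using braid_of_insert_Delta[of K c L] braid_of_Delta[of "K @ flip L"] V by simp
  then have "nf (braid_of V) =
      (fst (nf (braid_of (flip (K @ flip L)))) + 1, snd (nf (braid_of (flip (K @ flip L)))))"
    by (simp only: nf_Delta_mult)
  moreover have "nf (braid_of V) = (int q, [])"
    using assms nf_Delta_power by simp
  ultimately have "q \<noteq> 0"
    using nf_positive_nonneg[of "flip (K @ flip L)"] by auto
  then obtain q' where q: "q = Suc q'" by (cases q) auto
  have "braid_of (K @ flip L) * Delta = Delta ^ q' * Delta"
    using assms V braid_of_insert_Delta[of K c L] q by (simp add: power_commutes)
  then have "braid_of (K @ flip L) = Delta ^ q'"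
    by (simp only: braid3.right_cancel)
  then show ?thesis using that(2) q V by blast
qed

inductive braid_move :: "gen list \<Rightarrow> gen list \<Rightarrow> bool" where
  braid_move: "braid_move (U @ [c, other c, c] @ V) (U @ [other c, c, other c] @ V)"

lemma braid_move_sym: "symp braid_move"
  unfolding symp_def
proof (intro allI impI)
  fix u v
  assume "braid_move u v"
  then show "braid_move v u"
  proof cases
    case (braid_move U c V)
    then show ?thesis using braid_move.braid_move[of U "other c" V] by simp
  qed
qed

lemma braid_moves_context:
  assumes "braid_move\<^sup>*\<^sup>* u v"
  shows "braid_move\<^sup>*\<^sup>* (x @ u @ y) (x @ v @ y)"
  using assms
proof (induction rule: rtranclp_induct)
  case (step v w)
  from step(2) have "braid_move (x @ v @ y) (x @ w @ y)"
  proof cases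
    case (braid_move U c V)
    then show ?thesis using braid_move.braid_move[of "x @ U" c "V @ y"] by simp
  qed
  then show ?case using step.IH by (rule rtranclp.rtrancl_into_rtrancl[rotated])
qed simp

abbreviation delta_power :: "nat \<Rightarrow> gen list" where
  "delta_power k \<equiv> concat (replicate k [S1, S2, S1])"

lemma braid_of_delta_power: "braid_of (delta_power k) = Delta ^ k"
  by (induction k) (simp_all add: Delta_def mult.assoc)

lemma delta_power_commute:
  "braid_move\<^sup>*\<^sup>* (c # delta_power k) (delta_power k @ [if even k then c else other c])"
proof (induction k arbitrary: c)
  case (Suc k)
  have 1: "braid_move\<^sup>*\<^sup>* [c, S1, S2, S1] [S1, S2, S1, other c]"
    using braid_move.braid_move[of "[S1]" S1 "[]"] braid_move.braid_move[of "[]" S2 "[S1]"]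
    by (cases c) auto
  have "braid_move\<^sup>*\<^sup>* (c # delta_power (Suc k)) ([S1, S2, S1] @ (other c # delta_power k))"
    using braid_moves_context[OF 1, of "[]" "delta_power k"] by simp
  also have "braid_move\<^sup>*\<^sup>* \<dots>
      ([S1, S2, S1] @ delta_power k @ [if even k then other c else c])"
    using braid_moves_context[OF Suc[of "other c"], of "[S1, S2, S1]" "[]"]
    by (cases "even k") simp_all
  finally show ?case by (cases "even k") simp_all
qed simp

lemma delta_power_Suc: "delta_power (Suc k) = delta_power k @ [S1, S2, S1]"
  by (induction k) simp_all

text \<open>
  Left multiplication by a letter on normal forms is realized by braid moves: these carry the
  letter past \<open>\<Delta>\<^sup>k\<close> and, where necessary, turn \<open>b a b\<close> into \<open>a b a\<close>.
\<close>

lemma braid_moves_nf: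
  "\<exists>k w. nf (braid_of V) = (int k, w) \<and> braid_move\<^sup>*\<^sup>* V (delta_power k @ w)"
proof (induction V)
  case Nil
  then show ?case by (intro exI[of _ 0]) auto
next
  case (Cons c V)
  then obtain k w where IH: "nf (braid_of V) = (int k, w)"
    "braid_move\<^sup>*\<^sup>* V (delta_power k @ w)" by blast
  define d where "d = (if even k then c else other c)"
  have "braid_move\<^sup>*\<^sup>* (c # V) (c # delta_power k @ w)"
    using braid_moves_context[OF IH(2), of "[c]" "[]"] by simp
  also have "braid_move\<^sup>*\<^sup>* \<dots> (delta_power k @ d # w)"
    using braid_moves_context[OF delta_power_commute[of c k], of "[]" w]
    by (simp add: d_def)
  finally have 1: "braid_move\<^sup>*\<^sup>* (c # V) (delta_power k @ d # w)" .
  have 2: "nf (braid_of (c # V)) = lmul c (int k, w)"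
    using IH(1) by (simp add: nf_sigma_mult del: lmul.simps)
  show ?case
  proof (cases "take 2 w = [other d, d]")
    case True
    then have w: "w = [other d, d] @ drop 2 w" by (metis append_take_drop_id)
    have "braid_move\<^sup>*\<^sup>* ([d, other d, d] @ drop 2 w) ([S1, S2, S1] @ drop 2 w)"
      using braid_move.braid_move[of "[]" d "drop 2 w"] by (cases d) auto
    from braid_moves_context[OF this, of "delta_power k" "[]"]
    have "braid_move\<^sup>*\<^sup>* (delta_power k @ d # w) (delta_power k @ [S1, S2, S1] @ drop 2 w)"
      using w by (metis append.right_neutral append_Cons append_Nil)
    also have "delta_power k @ [S1, S2, S1] @ drop 2 w = delta_power (Suc k) @ drop 2 w"
      by (simp add: delta_power_Suc del: replicate.simps)
    finally have "braid_move\<^sup>*\<^sup>* (c # V) (delta_power (Suc k) @ drop 2 w)"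
      using 1 by (meson rtranclp_trans)
    moreover have "nf (braid_of (c # V)) = (int (Suc k), drop 2 w)"
      using 2 True by (simp add: d_def split: if_splits)
    ultimately show ?thesis by blast
  next
    case False
    then have "nf (braid_of (c # V)) = (int k, d # w)"
      using 2 by (auto simp add: d_def split: if_splits)
    then show ?thesis using 1 by blast
  qed
qed

text \<open>
  Both words can be moved to the word that spells out their common normal form.
\<close>

lemma braid_moves_connect:
  assumes "braid_of V = braid_of V'"
  shows "braid_move\<^sup>*\<^sup>* V V'"
proof -
  obtain k w where kw: "nf (braid_of V) = (int k, w)" "braid_move\<^sup>*\<^sup>* V (delta_power k @ w)"
    using braid_moves_nf by blast
  moreover obtain k' w' where "nf (braid_of V') = (int k', w')"
    "braid_move\<^sup>*\<^sup>* V' (delta_power k' @ w')"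
    using braid_moves_nf by blast
  ultimately have "braid_move\<^sup>*\<^sup>* V' (delta_power k @ w)" using assms by simp
  then have "braid_move\<^sup>*\<^sup>* (delta_power k @ w) V'"
    using symp_rtranclp[OF braid_move_sym] by (meson sympD)
  then show ?thesis using kw(2) by (meson rtranclp_trans)
qed

section \<open>Exchanging deletions in words for powers of \<open>\<Delta>\<close>\<close>

text \<open>
  A deletion found after pulling out a triple can be carried out in the original word.  The
  continuation \<open>S\<close> is left free because \<open>\<Delta>\<close> has to pass whatever follows.
\<close>

lemma lift_deletion:
  assumes "K @ flip L = M1 @ [y] @ M2"
  shows "\<exists>N1 z N2. K @ [c, other c, c] @ L = N1 @ [z] @ N2 \<and>
    (\<forall>S. braid_of (N1 @ N2 @ S) = braid_of (M1 @ M2 @ flip S) * Delta)"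
proof -
  consider K2 where "K = M1 @ [y] @ K2" "M2 = K2 @ flip L"
    | L1 where "M1 = K @ L1" "flip L = L1 @ [y] @ M2"
    using assms by (auto simp: append_eq_append_conv2 append_eq_Cons_conv Cons_eq_append_conv)
  then show ?thesis
  proof cases
    case 1
    have "braid_of (M1 @ (K2 @ [c, other c, c] @ L) @ S) = braid_of (M1 @ M2 @ flip S) * Delta" for S
      using braid_of_insert_Delta[of "M1 @ K2" c "L @ S"] 1 by (simp add: mult.assoc)
    then show ?thesis using 1
      by (intro exI[of _ M1] exI[of _ y] exI[of _ "K2 @ [c, other c, c] @ L"]) auto
  next
    case 2
    from arg_cong[OF 2(2), of flip] have L: "L = flip L1 @ [other y] @ flip M2" by simp
    have "braid_of ((K @ [c, other c, c] @ flip L1) @ flip M2 @ S)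
        = braid_of (M1 @ M2 @ flip S) * Delta" for S
      using braid_of_insert_Delta[of K c "flip L1 @ flip M2 @ S"] 2 by (simp add: mult.assoc)
    then show ?thesis using L
      by (intro exI[of _ "K @ [c, other c, c] @ flip L1"] exI[of _ "other y"] exI[of _ "flip M2"]) auto
  qed
qed

lemma braid_of_triple: "braid_of [c, other c, c] = braid_of [other c, c, other c]"
  using Delta_eq[of c] Delta_eq[of "other c"] by (simp add: mult.assoc)

lemma braid_of_triple_context:
  "braid_of (U @ [c, other c, c] @ V) = braid_of (U @ [other c, c, other c] @ V)"
  using braid_of_triple[of c] by (simp only: braid_of_simps(3))

lemma square_triple_split:
  assumes V: "R1 @ [a, a] @ R2 = K @ [c, other c, c] @ L"
  obtains (left) L1 where "R1 = K @ [c, other c, c] @ L1" "L = L1 @ [a, a] @ R2"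
    | (left_overlap) "c = a" "R1 = K @ [a, other a]" "L = a # R2"
    | (right_overlap) "c = a" "K = R1 @ [a]" "R2 = [other a, a] @ L"
    | (right) K2 where "K = R1 @ [a, a] @ K2" "R2 = K2 @ [c, other c, c] @ L"
proof -
  from V consider us where "R1 = K @ us" "us @ a # a # R2 = c # other c # c # L"
    | us where "K = R1 @ us" "a # a # R2 = us @ c # other c # c # L"
    by (auto simp: append_eq_append_conv2)
  then show ?thesis
  proof cases
    case 1
    then consider "us = []" | "us = [c]" | "us = [c, other c]" | us' where "us = c # other c # c # us'"
      by (auto simp: append_eq_Cons_conv)
    then show ?thesis using 1 left left_overlap by cases auto
  next
    case 2
    then consider "us = []" | "us = [a]" | us' where "us = a # a # us'"
      by (auto simp: Cons_eq_append_conv)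
    then show ?thesis using 2 right right_overlap by cases auto
  qed
qed
lemma end_triple_split:
  assumes V: "R @ s = K @ [c, other c, c] @ L" and s: "s \<in> {[], [other x], [other x, x]}"
  obtains (inside) L1 where "R = K @ [c, other c, c] @ L1" "L = L1 @ s"
    | (overlap) R' where "R = R' @ [x]"
proof -
  from V s consider us where "R = K @ us" "us @ s = c # other c # c # L"
    by (auto simp: append_eq_append_conv2 append_eq_Cons_conv Cons_eq_append_conv)
  then show ?thesis
  proof cases
    case 1
    then consider "us = []" | "us = [c]" | "us = [c, other c]" | us' where "us = c # other c # c # us'"
      by (auto simp: append_eq_Cons_conv)
    then show ?thesis using 1 inside overlap s by cases auto
  qed
qed

text \<open>
  The crucial exchange: if deleting the middle letter of \<open>a b a\<close> in \<open>R\<^sub>1 a b a R\<^sub>2\<close> gives a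
  power of \<open>\<Delta>\<close>, then deleting some letter outside that triple gives the same power.
\<close>

lemma replace_between_equal:
  assumes "braid_of (R1 @ [a, a] @ R2) = Delta ^ q"
  shows "(\<exists>M1 y M2. R1 = M1 @ [y] @ M2 \<and>
            braid_of (M1 @ M2 @ [a, other a, a] @ R2) = Delta ^ q) \<or>
         (\<exists>M1 y M2. R2 = M1 @ [y] @ M2 \<and>
            braid_of (R1 @ [a, other a, a] @ M1 @ M2) = Delta ^ q)"
  using assms
proof (induction q arbitrary: R1 a R2)
  case 0
  from 0 show ?case by (cases rule: delta_word_cases) auto
next
  case (Suc q)
  from Suc.prems obtain K c L where V: "R1 @ [a, a] @ R2 = K @ [c, other c, c] @ L"
    and q: "braid_of (K @ flip L) = Delta ^ q"
    by (cases rule: delta_word_cases) auto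
  from V show ?case
  proof (cases rule: square_triple_split)
    case (left L1)
    then have "braid_of ((K @ flip L1) @ [other a, other a] @ flip R2) = Delta ^ q"
      using q by simp
    from Suc.IH[OF this] consider
      M1 y M2 where "K @ flip L1 = M1 @ [y] @ M2"
        "braid_of (M1 @ M2 @ [other a, a, other a] @ flip R2) = Delta ^ q"
      | M1 y M2 where "flip R2 = M1 @ [y] @ M2"
        "braid_of ((K @ flip L1) @ [other a, a, other a] @ M1 @ M2) = Delta ^ q"
      by (metis other_other)
    then show ?thesis
    proof cases
      case (1 M1 y M2)
      from lift_deletion[OF 1(1), of c] obtain N1 z N2 where
        "R1 = N1 @ [z] @ N2"
        "\<And>S. braid_of (N1 @ N2 @ S) = braid_of (M1 @ M2 @ flip S) * Delta"
        using \<open>R1 = K @ [c, other c, c] @ L1\<close> by blast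
      moreover from this have
        "braid_of (N1 @ N2 @ [a, other a, a] @ R2) = Delta ^ Suc q"
        using 1(2) by (simp only: power_Suc2 other_other list.map append_Cons append_Nil)
      ultimately show ?thesis by blast
    next
      case (2 M1 y M2)
      from arg_cong[OF 2(1), of flip] have "R2 = flip M1 @ [other y] @ flip M2" by simp
      moreover have "braid_of (R1 @ [a, other a, a] @ flip M1 @ flip M2)
          = braid_of ((K @ flip L1) @ [other a, a, other a] @ M1 @ M2) * Delta"
        using \<open>R1 = K @ [c, other c, c] @ L1\<close>
          braid_of_insert_Delta[of K c "L1 @ [a, other a, a] @ flip M1 @ flip M2"]
        by simp
      then have "braid_of (R1 @ [a, other a, a] @ flip M1 @ flip M2) = Delta ^ Suc q"
        using 2(2) by (simp only: power_Suc2)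
      ultimately show ?thesis by blast
    qed
  next
    case left_overlap
    \<comment> \<open>By \<open>a b a a = b a b a\<close> the letter before the last of \<open>R\<^sub>1\<close> can be deleted.\<close>
    have "braid_of (K @ [other a] @ [a, other a, a] @ R2) = Delta ^ Suc q"
      using Suc.prems left_overlap braid_of_triple_context[of K a "[a] @ R2"] by simp
    then show ?thesis using left_overlap(2)
      by (intro disjI1 exI[of _ K] exI[of _ a] exI[of _ "[other a]"]) simp
  next
    case right_overlap
    \<comment> \<open>By \<open>a a b a = a b a b\<close> the second letter of \<open>R\<^sub>2\<close> can be deleted.\<close>
    have "braid_of (R1 @ [a, other a, a] @ [other a] @ L) = Delta ^ Suc q"
      using Suc.prems right_overlap braid_of_triple_context[of "R1 @ [a]" a L] by simp
    then show ?thesis using right_overlap(3)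
      by (intro disjI2 exI[of _ "[other a]"] exI[of _ a] exI[of _ L]) simp
  next
    case (right K2)
    then have "braid_of (R1 @ [a, a] @ (K2 @ flip L)) = Delta ^ q"
      using q by simp
    from Suc.IH[OF this] consider
      M1 y M2 where "K2 @ flip L = M1 @ [y] @ M2"
        "braid_of (R1 @ [a, other a, a] @ M1 @ M2) = Delta ^ q"
      | M1 y M2 where "R1 = M1 @ [y] @ M2"
        "braid_of (M1 @ M2 @ [a, other a, a] @ K2 @ flip L) = Delta ^ q"
      by blast
    then show ?thesis
    proof cases
      case (1 M1 y M2)
      from lift_deletion[OF 1(1), of c] obtain N1 z N2 where
        N: "R2 = N1 @ [z] @ N2"
        "\<And>S. braid_of (N1 @ N2 @ S) = braid_of (M1 @ M2 @ flip S) * Delta"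
        using right(2) by blast
      have "braid_of (R1 @ [a, other a, a] @ N1 @ N2)
          = braid_of (R1 @ [a, other a, a] @ M1 @ M2) * Delta"
        using N(2)[of "[]"] by (simp add: mult.assoc)
      then have "braid_of (R1 @ [a, other a, a] @ N1 @ N2) = Delta ^ Suc q"
        using 1(2) by (simp only: power_Suc2)
      then show ?thesis using N(1) by blast
    next
      case (2 M1 y M2)
      have "braid_of (M1 @ M2 @ [a, other a, a] @ R2)
          = braid_of (M1 @ M2 @ [a, other a, a] @ K2 @ flip L) * Delta"
        using right(2) braid_of_insert_Delta[of "M1 @ M2 @ [a, other a, a] @ K2" c L]
        by simp
      then have "braid_of (M1 @ M2 @ [a, other a, a] @ R2) = Delta ^ Suc q"
        using 2(2) by (simp only: power_Suc2)
      then show ?thesis using 2(1) by blast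
    qed
  qed
qed

text \<open>
  The analogous exchange for a letter \<open>x\<close> near the end of the word, where \<open>s\<close> is one of the
  possible continuations of \<open>x\<close> inside a final alternating triple.  Triples within \<open>R\<close> are
  pulled out as long as \<open>q > 0\<close>.  If a triple reaches into \<open>s\<close>, then \<open>x\<close> is also the last
  letter of \<open>R\<close>, and that letter can be deleted instead.
\<close>

lemma replace_near_end:
  assumes "braid_of (R @ s) = Delta ^ Suc q" "s \<in> {[], [other x], [other x, x]}"
  shows "\<exists>M1 y M2. R = M1 @ [y] @ M2 \<and> braid_of (M1 @ M2 @ [x] @ s) = Delta ^ Suc q"
  using assms
proof (induction q arbitrary: R s x)
  case (0 R s x)
  from 0(1) obtain K c L where V: "R @ s = K @ [c, other c, c] @ L"
    and q: "braid_of (K @ flip L) = Delta ^ 0"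
    by (cases rule: delta_word_cases) auto
  from q have "K = []" "L = []" by (cases rule: delta_word_cases; simp)+
  with V have V: "R @ s = [c, other c, c]" by simp
  show ?case
  proof (cases s)
    case Nil
    \<comment> \<open>Here \<open>R\<close> is a single triple.  If it ends with \<open>x\<close>, this last letter is deleted;
      otherwise deleting the first letter leaves an alternating word \<open>c' c c'\<close>.\<close>
    have "braid_of [other c, c, other c] = Delta ^ Suc 0"
      by (simp add: Delta_eq[of "other c"] mult.assoc)
    moreover have "braid_of [c, other c, c] = Delta ^ Suc 0"
      by (simp add: Delta_eq[of c] mult.assoc)
    ultimately show ?thesis
    proof (cases "x = c")
      case True
      then show ?thesis using V Nil \<open>braid_of [c, other c, c] = Delta ^ Suc 0\<close>
        by (intro exI[of _ "[c, other c]"] exI[of _ c] exI[of _ "[]"]) simp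
    next
      case False
      then show ?thesis using V Nil \<open>braid_of [other c, c, other c] = Delta ^ Suc 0\<close> neq_imp_other[of x c]
        by (intro exI[of _ "[]"] exI[of _ c] exI[of _ "[other c, c]"]) simp
    qed
  next
    case (Cons z s')
    then obtain R' where "R = R' @ [x]"
      using V 0(2) by (auto simp: append_eq_Cons_conv)
    then show ?thesis using 0(1)
      by (intro exI[of _ R'] exI[of _ x] exI[of _ "[]"]) simp
  qed
next
  case (Suc q)
  from Suc.prems(1) obtain K c L where V: "R @ s = K @ [c, other c, c] @ L"
    and q: "braid_of (K @ flip L) = Delta ^ Suc q"
    by (cases rule: delta_word_cases) auto
  from V Suc.prems(2) show ?case
  proof (cases rule: end_triple_split)
    case (inside L1)
    then have "braid_of ((K @ flip L1) @ flip s) = Delta ^ Suc q" using q by simp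
    moreover have "flip s \<in> {[], [other (other x)], [other (other x), other x]}"
      using Suc.prems(2) by auto
    ultimately have "\<exists>M1 y M2. K @ flip L1 = M1 @ [y] @ M2 \<and>
        braid_of (M1 @ M2 @ [other x] @ flip s) = Delta ^ Suc q"
      by (rule Suc.IH)
    then obtain M1 y M2 where M: "K @ flip L1 = M1 @ [y] @ M2"
      "braid_of (M1 @ M2 @ [other x] @ flip s) = Delta ^ Suc q"
      by blast
    from lift_deletion[OF M(1), of c] obtain N1 z N2 where
      N: "R = N1 @ [z] @ N2"
      "\<And>S. braid_of (N1 @ N2 @ S) = braid_of (M1 @ M2 @ flip S) * Delta"
      using inside by blast
    have "braid_of (N1 @ N2 @ [x] @ s) = Delta ^ Suc q * Delta"
      using N(2)[of "[x] @ s"] M(2) by simp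
    then show ?thesis using N(1) by (metis power_Suc2)
  next
    case (overlap R')
    then show ?thesis using Suc.prems(1)
      by (intro exI[of _ R'] exI[of _ x] exI[of _ "[]"]) simp
  qed
qed

section \<open>Hurwitz equivalence\<close>

definition conjby :: "braid3 \<Rightarrow> braid3 \<Rightarrow> braid3" where
  "conjby g x = g * x * inverse g"

lemma cancel_left [simp]: "inverse x * (x * y) = y" "x * (inverse x * y) = (y :: braid3)"
  by (simp_all flip: mult.assoc)

lemma inverse_mult: "inverse (x * y) = inverse y * inverse (x :: braid3)"
  by (rule braid3.inverse_distrib_swap)

lemma conjby_mult: "conjby g (x * y) = conjby g x * conjby g y"
  by (simp add: conjby_def mult.assoc)

lemma conjby_inverse: "conjby g (inverse x) = inverse (conjby g x)"
  by (simp add: conjby_def inverse_mult mult.assoc)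

lemma conjby_conjby: "conjby g (conjby h x) = conjby (g * h) x"
  by (simp add: conjby_def inverse_mult mult.assoc)

lemma conjby_one [simp]: "conjby 1 x = x"
  by (simp add: conjby_def)

lemma conjby_eqI: "g * x = y * g \<Longrightarrow> conjby g x = y"
  by (simp add: conjby_def mult.assoc)

inductive hurwitz_move :: "braid3 list \<Rightarrow> braid3 list \<Rightarrow> bool" where
  hurwitz_move: "hurwitz_move (us @ [x, y] @ vs) (us @ [x * y * inverse x, x] @ vs)"

abbreviation hurwitz_eq :: "braid3 list \<Rightarrow> braid3 list \<Rightarrow> bool" (infix "\<approx>" 50) where
  "Xs \<approx> Ys \<equiv> equivclp hurwitz_move Xs Ys"

lemma hurwitz_eq_sym: "Xs \<approx> Ys \<Longrightarrow> Ys \<approx> Xs"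
  by (rule equivclp_sym)

lemma hurwitz_eq_trans [trans]: "Xs \<approx> Ys \<Longrightarrow> Ys \<approx> Zs \<Longrightarrow> Xs \<approx> Zs"
  by (rule equivclp_trans)

lemma hurwitz_eq_append:
  assumes "Xs \<approx> Ys"
  shows "Us @ Xs @ Vs \<approx> Us @ Ys @ Vs"
  using assms
proof (induction rule: equivclp_induct)
  case (step Y Z)
  have move: "hurwitz_move (Us @ A @ Vs) (Us @ B @ Vs)" if "hurwitz_move A B" for A B
    using that
  proof cases
    case (hurwitz_move us x y vs)
    then show ?thesis using hurwitz_move.hurwitz_move[of "Us @ us" x y "vs @ Vs"] by simp
  qed
  from step(2) have "hurwitz_move (Us @ Y @ Vs) (Us @ Z @ Vs) \<or> hurwitz_move (Us @ Z @ Vs) (Us @ Y @ Vs)"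
    using move by blast
  then show ?case using step(3) by (rule equivclp_into_equivclp[rotated])
qed simp

lemma hurwitz_eq_conjby:
  assumes "Xs \<approx> Ys"
  shows "map (conjby g) Xs \<approx> map (conjby g) Ys"
  using assms
proof (induction rule: equivclp_induct)
  case (step Y Z)
  have move: "hurwitz_move (map (conjby g) A) (map (conjby g) B)" if "hurwitz_move A B" for A B
    using that
  proof cases
    case (hurwitz_move us x y vs)
    then show ?thesis
      using hurwitz_move.hurwitz_move[of "map (conjby g) us" "conjby g x" "conjby g y" "map (conjby g) vs"]
      by (simp add: conjby_mult conjby_inverse)
  qed
  from step(2) have "hurwitz_move (map (conjby g) Y) (map (conjby g) Z)
      \<or> hurwitz_move (map (conjby g) Z) (map (conjby g) Y)"
    using move by blast
  then show ?case using step(3) by (rule equivclp_into_equivclp[rotated])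
qed simp

lemma hurwitz_eq_pair: "[x, y] \<approx> [conjby x y, x]"
  using hurwitz_move.hurwitz_move[of "[]" x y "[]"] by (simp add: conjby_def r_into_equivclp)

text \<open>
  Moving the first entry to the end by Hurwitz moves conjugates the entries that it passes.
\<close>

lemma hurwitz_eq_move_last: "Y # map (conjby (inverse Y)) Xs \<approx> Xs @ [Y]"
proof (induction Xs)
  case (Cons X Xs)
  have "conjby Y (conjby (inverse Y) X) = X" by (simp add: conjby_conjby)
  then have "[Y, conjby (inverse Y) X] \<approx> [X, Y]"
    using hurwitz_eq_pair[of Y "conjby (inverse Y) X"] by simp
  then have "Y # map (conjby (inverse Y)) (X # Xs) \<approx> [X] @ Y # map (conjby (inverse Y)) Xs"
    using hurwitz_eq_append[of _ _ "[]" "map (conjby (inverse Y)) Xs"] by fastforce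
  also have "\<dots> \<approx> [X] @ Xs @ [Y]"
    using hurwitz_eq_append[OF Cons, of "[X]" "[]"] by simp
  finally show ?case by simp
qed simp

lemma length_hurwitz [simp]: "length (hurwitz i Xs) = length Xs" "length (hurwitz_inv i Xs) = length Xs"
  by (simp_all add: hurwitz_def hurwitz_inv_def)

lemma hurwitz_act_Cons:
  "hurwitz_act ((i, e) # b) Xs = (if e then hurwitz i else hurwitz_inv i) (hurwitz_act b Xs)"
  by (simp add: hurwitz_act_def)

lemma length_hurwitz_act: "length (hurwitz_act b Xs) = length Xs"
  by (induction b) (auto simp: hurwitz_act_def)

lemma hurwitz_orbit_step:
  assumes "Ys \<in> hurwitz_orbit Xs" "1 \<le> i" "i < length Ys"
  shows "hurwitz i Ys \<in> hurwitz_orbit Xs" "hurwitz_inv i Ys \<in> hurwitz_orbit Xs"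
proof -
  obtain b where b: "Ys = hurwitz_act b Xs" "\<forall>(i, e) \<in> set b. 1 \<le> i \<and> i < length Xs"
    using assms(1) by (auto simp: hurwitz_orbit_def)
  have "hurwitz_act ((i, e) # b) Xs \<in> hurwitz_orbit Xs" for e
    using b assms unfolding hurwitz_orbit_def
    by (auto simp: length_hurwitz_act intro!: exI[of _ "(i, e) # b"])
  from this[of True] this[of False] show
    "hurwitz i Ys \<in> hurwitz_orbit Xs" "hurwitz_inv i Ys \<in> hurwitz_orbit Xs"
    using b(1) by (auto simp: hurwitz_act_Cons)
qed

lemma hurwitz_eq_orbit:
  assumes "Xs \<approx> Ys"
  shows "Ys \<in> hurwitz_orbit Xs"
  using assms
proof (induction rule: equivclp_induct)
  case base
  then show ?case by (auto simp: hurwitz_orbit_def hurwitz_act_def intro!: exI[of _ "[]"])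
next
  case (step Y Z)
  have move: "B = hurwitz (Suc n) A" "A = hurwitz_inv (Suc n) B"
    if "A = us @ [x, y] @ vs" "B = us @ [x * y * inverse x, x] @ vs" "n = length us" for A B n us vs and x y :: braid3
    using that by (simp_all add: hurwitz_def hurwitz_inv_def list_update_append nth_append mult.assoc)
  from step(2) show ?case
  proof
    assume "hurwitz_move Y Z"
    then show ?thesis
    proof cases
      case (hurwitz_move us x y vs)
      then have "Z = hurwitz (Suc (length us)) Y" using move(1) by blast
      then show ?thesis using hurwitz_orbit_step(1)[OF step(3), of "Suc (length us)"] hurwitz_move by simp
    qed
  next
    assume "hurwitz_move Z Y"
    then show ?thesis
    proof cases
      case (hurwitz_move us x y vs)
      then have "Z = hurwitz_inv (Suc (length us)) Y" using move(2) by blast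
      then show ?thesis using hurwitz_orbit_step(2)[OF step(3), of "Suc (length us)"] hurwitz_move by simp
    qed
  qed
qed

section \<open>Words with selected letters\<close>

text \<open>
  A word with selected letters is a list of letters marked by \<open>True\<close> if selected.  Unlike the
  pair of \<open>W\<close> and \<open>I\<close>, such lists can be concatenated.  The remainder is \<open>rest\<close>, and
  \<open>selection 1\<close> is \<open>W\<^sub>I\<close>; the first argument of \<open>selection\<close> accumulates the prefixes \<open>A\<^sub>j\<close>.
\<close>

abbreviation rest :: "(gen \<times> bool) list \<Rightarrow> gen list" where
  "rest m \<equiv> map fst (filter (\<lambda>p. \<not> snd p) m)"

fun selection :: "braid3 \<Rightarrow> (gen \<times> bool) list \<Rightarrow> braid3 list" where
  "selection g [] = []"
| "selection g ((x, True) # m) = conjby g (sigma x) # selection g m"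
| "selection g ((x, False) # m) = selection (g * sigma x) m"

lemma selection_append:
  "selection g (m1 @ m2) = selection g m1 @ selection (g * braid_of (rest m1)) m2"
  by (induction g m1 rule: selection.induct) (simp_all add: mult.assoc)

lemma selection_conjby: "selection (g * h) m = map (conjby g) (selection h m)"
  by (induction h m rule: selection.induct) (simp_all add: conjby_conjby mult.assoc)

lemma selection_unselected: "selection g (map (\<lambda>x. (x, False)) w) = []"
  by (induction w arbitrary: g) auto

text \<open>
  Selecting one more letter \<open>x\<close> removes it from the prefixes \<open>A\<^sub>j\<close> of all later entries.
  This conjugates these entries by the inverse of the new entry, and the same happens when
  Hurwitz moves bring the new entry back from the end of the tuple.
\<close>

lemma select_one_more:
  "selection 1 (m1 @ [(x, True)] @ m2) \<approx>
   selection 1 (m1 @ [(x, False)] @ m2) @ [conjby (braid_of (rest m1)) (sigma x)]"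
proof -
  define h where "h = braid_of (rest m1)"
  define Y where "Y = conjby h (sigma x)"
  have "inverse Y * (h * sigma x) = h"
    by (simp add: Y_def conjby_def inverse_mult mult.assoc)
  then have "selection h m2 = map (conjby (inverse Y)) (selection (h * sigma x) m2)"
    using selection_conjby[of "inverse Y" "h * sigma x" m2] by simp
  then have "selection 1 (m1 @ [(x, True)] @ m2) =
      selection 1 m1 @ (Y # map (conjby (inverse Y)) (selection (h * sigma x) m2)) @ []"
    by (simp add: selection_append h_def Y_def)
  also have "\<dots> \<approx> selection 1 m1 @ (selection (h * sigma x) m2 @ [Y]) @ []"
    by (rule hurwitz_eq_append[OF hurwitz_eq_move_last])
  also have "\<dots> = selection 1 (m1 @ [(x, False)] @ m2) @ [Y]"
    by (simp add: selection_append h_def)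
  finally show ?thesis by (simp add: Y_def h_def)
qed

text \<open>
  Both tuples arise from the one in which neither letter is selected by appending an entry, and
  this entry is the quotient of the remainder before and the remainder after the deletion.
\<close>

lemma swap_selected:
  assumes "braid_of (rest (m1 @ m2 @ [(x, False)] @ m3)) = braid_of (rest (m1 @ [(y, False)] @ m2 @ m3))"
  shows "selection 1 (m1 @ [(y, True)] @ m2 @ [(x, False)] @ m3) \<approx>
         selection 1 (m1 @ [(y, False)] @ m2 @ [(x, True)] @ m3)"
proof -
  let ?m = "m1 @ [(y, False)] @ m2 @ [(x, False)] @ m3"
  define Y where "Y = conjby (braid_of (rest m1)) (sigma y)"
  define Z where "Z = conjby (braid_of (rest (m1 @ [(y, False)] @ m2))) (sigma x)"
  have "Y * braid_of (rest (m1 @ m2 @ [(x, False)] @ m3)) = braid_of (rest ?m)"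
    by (simp add: Y_def conjby_def mult.assoc)
  also have "\<dots> = Z * braid_of (rest (m1 @ [(y, False)] @ m2 @ m3))"
    by (simp add: Z_def conjby_def inverse_mult mult.assoc)
  finally have "Y = Z" by (simp only: assms braid3.right_cancel)
  have "selection 1 (m1 @ [(y, True)] @ m2 @ [(x, False)] @ m3) \<approx> selection 1 ?m @ [Y]"
    using select_one_more[of m1 y "m2 @ [(x, False)] @ m3"] by (simp add: Y_def)
  also have "\<dots> \<approx> selection 1 (m1 @ [(y, False)] @ m2 @ [(x, True)] @ m3)"
    using select_one_more[of "m1 @ [(y, False)] @ m2" x m3, THEN hurwitz_eq_sym] \<open>Y = Z\<close>
    by (simp add: Z_def)
  finally show ?thesis .
qed

lemma rest_split:
  assumes "rest m = P @ [y] @ Q"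
  obtains m1 m2 where "m = m1 @ [(y, False)] @ m2" "rest m1 = P" "rest m2 = Q"
proof -
  have "\<exists>m1 m2. m = m1 @ [(y, False)] @ m2 \<and> rest m1 = P \<and> rest m2 = Q"
    using assms
  proof (induction m arbitrary: P)
    case (Cons p m)
    obtain x e where p: "p = (x, e)" by (cases p)
    have extend: ?case if P': "rest m = P' @ [y] @ Q" "P = (if e then P' else x # P')" for P'
    proof -
      obtain m1 m2 where "m = m1 @ [(y, False)] @ m2" "rest m1 = P'" "rest m2 = Q"
        using Cons.IH[OF P'(1)] by blast
      then show ?thesis using p P'(2) by (intro exI[of _ "p # m1"] exI[of _ m2]) auto
    qed
    show ?case
    proof (cases e)
      case True
      then have "rest m = P @ [y] @ Q" using Cons.prems p by simp
      then show ?thesis by (rule extend) (simp add: True)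
    next
      case False
      then have m: "x # rest m = P @ [y] @ Q" using Cons.prems p by simp
      show ?thesis
      proof (cases P)
        case Nil
        then show ?thesis using m p False by (intro exI[of _ "[]"] exI[of _ m]) simp
      next
        case (Cons z P')
        then have "rest m = P' @ [y] @ Q" using m by simp
        then show ?thesis by (rule extend) (use False Cons m in simp)
      qed
    qed
  qed simp
  then show ?thesis using that by blast
qed

lemma replace_factor:
  assumes "braid_of (rest t) = braid_of (rest t')" "selection 1 t \<approx> selection 1 t'"
  shows "selection 1 (m1 @ t @ m2) \<approx> selection 1 (m1 @ t' @ m2)"
    and "braid_of (rest (m1 @ t @ m2)) = braid_of (rest (m1 @ t' @ m2))"
proof -
  let ?g = "braid_of (rest m1)"
  have "selection ?g t \<approx> selection ?g t'"
    using hurwitz_eq_conjby[OF assms(2), of ?g] selection_conjby[of ?g 1] by simp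
  then show "selection 1 (m1 @ t @ m2) \<approx> selection 1 (m1 @ t' @ m2)"
    using hurwitz_eq_append assms(1) by (simp add: selection_append)
  show "braid_of (rest (m1 @ t @ m2)) = braid_of (rest (m1 @ t' @ m2))"
    using assms(1) by simp
qed

section \<open>Moving a selection to another positive word\<close>

definition realizes :: "nat \<Rightarrow> gen list \<Rightarrow> braid3 list \<Rightarrow> bool" where
  "realizes q V T \<longleftrightarrow>
     (\<exists>m. map fst m = V \<and> braid_of (rest m) = Delta ^ q \<and> selection 1 m \<approx> T)"

lemma sigma_braid: "sigma c * (sigma (other c) * sigma c) = sigma (other c) * (sigma c * sigma (other c))"
  using Delta_eq[of c] Delta_eq[of "other c"] by (simp add: mult.assoc)

lemma conjby_self [simp]: "conjby x x = x"
  by (simp add: conjby_def mult.assoc)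

lemma conjby_sigma_pair: "conjby (sigma c * sigma (other c)) (sigma c) = sigma (other c)"
  by (rule conjby_eqI) (simp add: sigma_braid mult.assoc)

lemma conjby_sigma_swap: "conjby (sigma (other c)) (conjby (sigma c) (sigma (other c))) = sigma c"
  unfolding conjby_conjby using conjby_sigma_pair[of "other c"] by simp

lemma hurwitz_sigma_pair: "[sigma (other c), conjby (sigma c) (sigma (other c))] \<approx> [sigma c, sigma (other c)]"
  using hurwitz_eq_pair[of "sigma (other c)" "conjby (sigma c) (sigma (other c))"]
  by (simp add: conjby_sigma_swap)

lemma hurwitz_sigma_triple:
  "[sigma c, sigma (other c), sigma c] \<approx> [sigma (other c), sigma c, sigma (other c)]"
proof -
  have "[sigma c, sigma (other c)] @ [sigma c] \<approx>
      [sigma (other c), conjby (sigma c) (sigma (other c))] @ [sigma c]"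
    using hurwitz_eq_append[OF hurwitz_sigma_pair[of c, THEN hurwitz_eq_sym], of "[]" "[sigma c]"] by simp
  also have "\<dots> = [sigma (other c)] @ [conjby (sigma c) (sigma (other c)), sigma c]" by simp
  also have "\<dots> \<approx> [sigma (other c)] @ [sigma c, sigma (other c)]"
    using hurwitz_eq_append[OF hurwitz_eq_pair[of "sigma c" "sigma (other c)", THEN hurwitz_eq_sym],
        of "[sigma (other c)]" "[]"] by simp
  finally show ?thesis by simp
qed

text \<open>
  The excluded pattern, in which only the middle letter is selected, leaves \<open>c c\<close>, and no
  selection in the other triple does.
\<close>

lemma braid_move_selection:
  assumes "\<not> (\<not> x \<and> y \<and> \<not> z)"
  shows "\<exists>x' y' z'.
    braid_of (rest [(c, x), (other c, y), (c, z)]) =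
      braid_of (rest [(other c, x'), (c, y'), (other c, z')]) \<and>
    selection 1 [(c, x), (other c, y), (c, z)] \<approx>
      selection 1 [(other c, x'), (c, y'), (other c, z')]"
proof -
  let ?t' = "\<lambda>x' y' z'. [(other c, x'), (c, y'), (other c, z')]"
  have inst: ?thesis if "braid_of (rest [(c, x), (other c, y), (c, z)]) = braid_of (rest (?t' x' y' z'))"
    "selection 1 [(c, x), (other c, y), (c, z)] \<approx> selection 1 (?t' x' y' z')" for x' y' z'
    using that by blast
  consider "\<not> x" "\<not> y" "\<not> z" | "x" "\<not> y" "\<not> z" | "\<not> x" "\<not> y" "z" | "x" "y" "\<not> z"
    | "\<not> x" "y" "z" | "x" "\<not> y" "z" | "x" "y" "z"
    using assms by blast
  then show ?thesis
  proof cases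
    case 1
    then show ?thesis
      by (intro inst[of False False False]) (simp_all add: sigma_braid)
  next
    case 2
    then show ?thesis
      using conjby_sigma_pair[of "other c"] by (intro inst[of False False True]) simp_all
  next
    case 3
    then show ?thesis
      using conjby_sigma_pair[of c] by (intro inst[of True False False]) simp_all
  next
    case 4
    then show ?thesis
      using hurwitz_sigma_pair[of c, THEN hurwitz_eq_sym]
      by (intro inst[of True False True]) simp_all
  next
    case 5
    have "[conjby (sigma c) (sigma (other c)), sigma c] \<approx> [sigma (other c), conjby (sigma c) (sigma (other c))]"
      using hurwitz_eq_pair[of "sigma c" "sigma (other c)", THEN hurwitz_eq_sym]
        hurwitz_sigma_pair[of c, THEN hurwitz_eq_sym]
      by (rule hurwitz_eq_trans)
    then show ?thesis using 5
      by (intro inst[of True False True]) simp_all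
  next
    case 6
    then show ?thesis
      using hurwitz_sigma_pair[of "other c"]
      by (intro inst[of True True False]) simp_all
  next
    case 7
    then show ?thesis
      using hurwitz_sigma_triple[of c] by (intro inst[of True True True]) simp_all
  qed
qed

text \<open>
  In the excluded pattern the selected middle letter is exchanged for a letter outside the triple.
  The letters of the triple are then all unselected.
\<close>

lemma unselect_middle:
  assumes "braid_of (rest (m1 @ [(c, False), (other c, True), (c, False)] @ m2)) = Delta ^ q"
  shows "\<exists>n1 n2. map fst n1 = map fst m1 \<and> map fst n2 = map fst m2 \<and>
    braid_of (rest (n1 @ [(c, False), (other c, False), (c, False)] @ n2)) = Delta ^ q \<and>
    selection 1 (m1 @ [(c, False), (other c, True), (c, False)] @ m2) \<approx>
    selection 1 (n1 @ [(c, False), (other c, False), (c, False)] @ n2)"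
proof -
  have "braid_of (rest m1 @ [c, c] @ rest m2) = Delta ^ q" using assms by simp
  from replace_between_equal[OF this] consider
    (left) P y Q where "rest m1 = P @ [y] @ Q"
      "braid_of (P @ Q @ [c, other c, c] @ rest m2) = Delta ^ q"
    | (right) P y Q where "rest m2 = P @ [y] @ Q"
      "braid_of (rest m1 @ [c, other c, c] @ P @ Q) = Delta ^ q"
    by blast
  then show ?thesis
  proof cases
    case left
    from left(1) obtain k1 k2 where k: "m1 = k1 @ [(y, False)] @ k2" "rest k1 = P" "rest k2 = Q"
      by (rule rest_split)
    have "selection 1 (k1 @ [(y, True)] @ (k2 @ [(c, False)]) @ [(other c, False)] @ ((c, False) # m2)) \<approx>
        selection 1 (k1 @ [(y, False)] @ (k2 @ [(c, False)]) @ [(other c, True)] @ ((c, False) # m2))"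
      using left(2) assms k by (intro swap_selected) simp
    then show ?thesis using left(2) k
      by (intro exI[of _ "k1 @ [(y, True)] @ k2"] exI[of _ m2]) (simp add: hurwitz_eq_sym)
  next
    case right
    from right(1) obtain k1 k2 where k: "m2 = k1 @ [(y, False)] @ k2" "rest k1 = P" "rest k2 = Q"
      by (rule rest_split)
    have "selection 1 ((m1 @ [(c, False)]) @ [(other c, True)] @ ((c, False) # k1) @ [(y, False)] @ k2) \<approx>
        selection 1 ((m1 @ [(c, False)]) @ [(other c, False)] @ ((c, False) # k1) @ [(y, True)] @ k2)"
      using right(2) assms k by (intro swap_selected) simp
    then show ?thesis using right(2) k
      by (intro exI[of _ m1] exI[of _ "k1 @ [(y, True)] @ k2"]) simp
  qed
qed

lemma realizes_braid_move:
  assumes "realizes q V T" "braid_move V V'"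
  shows "realizes q V' T"
proof -
  obtain U c U' where V: "V = U @ [c, other c, c] @ U'" "V' = U @ [other c, c, other c] @ U'"
    using assms(2) by (auto elim: braid_move.cases)
  obtain m where m: "map fst m = V" "braid_of (rest m) = Delta ^ q" "selection 1 m \<approx> T"
    using assms(1) by (auto simp: realizes_def)
  obtain m1 x y z m2 where split: "m = m1 @ [(c, x), (other c, y), (c, z)] @ m2"
    "map fst m1 = U" "map fst m2 = U'"
    using m(1) V(1) by (auto simp: map_eq_append_conv map_eq_Cons_conv)
  have "\<exists>n1 x y z n2. map fst n1 = U \<and> map fst n2 = U' \<and> \<not> (\<not> x \<and> y \<and> \<not> z) \<and>
    braid_of (rest (n1 @ [(c, x), (other c, y), (c, z)] @ n2)) = Delta ^ q \<and>
    selection 1 (n1 @ [(c, x), (other c, y), (c, z)] @ n2) \<approx> T"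
  proof (cases "\<not> x \<and> y \<and> \<not> z")
    case True
    then obtain n1 n2 where "map fst n1 = U" "map fst n2 = U'"
      "braid_of (rest (n1 @ [(c, False), (other c, False), (c, False)] @ n2)) = Delta ^ q"
      "selection 1 m \<approx> selection 1 (n1 @ [(c, False), (other c, False), (c, False)] @ n2)"
      using unselect_middle[of m1 c m2 q] m(2) split by auto
    then show ?thesis using m(3) hurwitz_eq_sym hurwitz_eq_trans by blast
  next
    case False
    then show ?thesis using m split by blast
  qed
  then obtain n1 x y z n2 where n: "map fst n1 = U" "map fst n2 = U'" "\<not> (\<not> x \<and> y \<and> \<not> z)"
    "braid_of (rest (n1 @ [(c, x), (other c, y), (c, z)] @ n2)) = Delta ^ q"
    "selection 1 (n1 @ [(c, x), (other c, y), (c, z)] @ n2) \<approx> T" by blast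
  from braid_move_selection[OF n(3), of c] obtain x' y' z' where t:
    "braid_of (rest [(c, x), (other c, y), (c, z)]) =
      braid_of (rest [(other c, x'), (c, y'), (other c, z')])"
    "selection 1 [(c, x), (other c, y), (c, z)] \<approx>
      selection 1 [(other c, x'), (c, y'), (other c, z')]" by blast
  let ?m = "n1 @ [(other c, x'), (c, y'), (other c, z')] @ n2"
  have "map fst ?m = V'" using V(2) n(1,2) by simp
  moreover have "braid_of (rest ?m) = Delta ^ q"
    using replace_factor(2)[OF t] n(4) by metis
  moreover have "selection 1 ?m \<approx> T"
    using replace_factor(1)[OF t] n(5) hurwitz_eq_sym hurwitz_eq_trans by meson
  ultimately show ?thesis unfolding realizes_def by blast
qed

lemma realizes_braid_eq:
  assumes "realizes q V T" "braid_of V = braid_of V'"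
  shows "realizes q V' T"
  using braid_moves_connect[OF assms(2)]
  by (induction rule: rtranclp_induct) (auto intro: assms(1) realizes_braid_move)

abbreviation unselected :: "gen list \<Rightarrow> (gen \<times> bool) list" where
  "unselected w \<equiv> map (\<lambda>x. (x, False)) w"

lemma fst_comp_unselected [simp]: "fst \<circ> (\<lambda>x. (x, b)) = id"
  by auto

lemma filter_unselected [simp]: "filter (\<lambda>p. \<not> snd p) (unselected w) = unselected w"
  by (induction w) auto

lemma unselect_near_end:
  assumes "braid_of (rest (m @ [(x, e)] @ unselected s)) = Delta ^ Suc q"
    "s \<in> {[], [other x], [other x, x]}"
  shows "\<exists>n. map fst n = map fst m \<and>
    braid_of (rest (n @ unselected (x # s))) = Delta ^ Suc q \<and>
    selection 1 (m @ [(x, e)] @ unselected s) \<approx> selection 1 (n @ unselected (x # s))"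
proof (cases e)
  case True
  with assms(1) have "braid_of (rest m @ s) = Delta ^ Suc q" by simp
  then obtain P y Q where "rest m = P @ [y] @ Q"
    and PQ: "braid_of (P @ Q @ [x] @ s) = Delta ^ Suc q"
    using replace_near_end assms(2) by blast
  then obtain k1 k2 where k: "m = k1 @ [(y, False)] @ k2" "rest k1 = P" "rest k2 = Q"
    using rest_split by metis
  have "selection 1 (k1 @ [(y, True)] @ k2 @ [(x, False)] @ unselected s) \<approx>
      selection 1 (k1 @ [(y, False)] @ k2 @ [(x, True)] @ unselected s)"
    using PQ assms True k by (intro swap_selected) simp
  then show ?thesis using k True PQ
    by (intro exI[of _ "k1 @ [(y, True)] @ k2"]) (auto intro: hurwitz_eq_sym)
next
  case False
  then show ?thesis using assms by (intro exI[of _ m]) auto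
qed

lemma map_fst_snoc: "map fst m = V @ [c] \<Longrightarrow> \<exists>k e. m = k @ [(c, e)] \<and> map fst k = V"
  by (cases m rule: rev_cases) auto

text \<open>
  The letters of the final \<open>\<Delta>\<close> are made unselected from right to left.  Each exchange only
  affects letters further left, so it does not spoil what has been achieved.
\<close>

lemma realizes_cancel_Delta:
  assumes "realizes (Suc q) (V @ [S1, S2, S1]) T"
  shows "realizes q V T"
proof -
  obtain m where m: "map fst m = V @ [S1, S2, S1]" "braid_of (rest m) = Delta ^ Suc q"
    "selection 1 m \<approx> T"
    using assms by (auto simp: realizes_def)
  obtain m0 x y z where split: "m = m0 @ [(S1, x), (S2, y), (S1, z)]" "map fst m0 = V"
    using m(1) by (auto simp: map_eq_append_conv map_eq_Cons_conv)
  obtain m1 where m1: "map fst m1 = V @ [S1, S2]"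
    "braid_of (rest (m1 @ unselected [S1])) = Delta ^ Suc q"
    "selection 1 m \<approx> selection 1 (m1 @ unselected [S1])"
    using unselect_near_end[of "m0 @ [(S1, x), (S2, y)]" S1 z "[]" q] m(2) split by auto
  obtain k1 y' where k1: "m1 = k1 @ [(S2, y')]" "map fst k1 = V @ [S1]"
    using m1(1) map_fst_snoc[of m1 "V @ [S1]" S2] by auto
  obtain m2 where m2: "map fst m2 = V @ [S1]"
    "braid_of (rest (m2 @ unselected [S2, S1])) = Delta ^ Suc q"
    "selection 1 (m1 @ unselected [S1]) \<approx> selection 1 (m2 @ unselected [S2, S1])"
    using unselect_near_end[of k1 S2 y' "[S1]" q] m1(2) k1 by auto
  obtain k2 x' where k2: "m2 = k2 @ [(S1, x')]" "map fst k2 = V"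
    using m2(1) map_fst_snoc[of m2 V S1] by auto
  obtain m3 where m3: "map fst m3 = V"
    "braid_of (rest (m3 @ unselected [S1, S2, S1])) = Delta ^ Suc q"
    "selection 1 (m2 @ unselected [S2, S1]) \<approx> selection 1 (m3 @ unselected [S1, S2, S1])"
    using unselect_near_end[of k2 S1 x' "[S2, S1]" q] m2(2) k2 by auto
  have "braid_of (rest m3) * Delta = Delta ^ q * Delta"
    using m3(2) by (simp add: Delta_def mult.assoc flip: power_commutes)
  then have "braid_of (rest m3) = Delta ^ q" by (simp only: braid3.right_cancel)
  moreover have "selection 1 m3 = selection 1 (m3 @ unselected [S1, S2, S1])"
    by (simp add: selection_append)
  then have "selection 1 m3 \<approx> T"
    using m(3) m1(3) m2(3) m3(3) by (metis hurwitz_eq_sym hurwitz_eq_trans)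
  ultimately show ?thesis using m3(1) unfolding realizes_def by blast
qed

lemma realizes_cancel_delta_power:
  "realizes (n + p) (V @ delta_power n) T \<Longrightarrow> realizes p V T"
proof (induction n)
  case (Suc n)
  then have "realizes (Suc (n + p)) ((V @ delta_power n) @ [S1, S2, S1]) T"
    by (simp only: delta_power_Suc append_assoc add_Suc)
  then show ?case using realizes_cancel_Delta Suc.IH by blast
qed simp

section \<open>Every factorization is read off from some positive word\<close>

lemma braid3_induct [case_names one sigma inverse_sigma]:
  assumes "P 1" "\<And>c g. P g \<Longrightarrow> P (sigma c * g)" "\<And>c g. P g \<Longrightarrow> P (inverse (sigma c) * g)"
  shows "P g"
proof -
  have "P (abs_braid3 w)" for w
  proof (induction w)
    case Nil
    then show ?case using assms(1) by (simp add: one_braid3.abs_eq)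
  next
    case (Cons p w)
    obtain c e where p: "p = (c, e)" by (cases p)
    have "abs_braid3 ((c, True) # w) = sigma c * abs_braid3 w"
      by (simp add: sigma.abs_eq times_braid3.abs_eq)
    moreover have "abs_braid3 ((c, False) # w) = inverse (sigma c) * abs_braid3 w"
      by (simp add: sigma.abs_eq times_braid3.abs_eq inverse_braid3.abs_eq word_inv_def)
    ultimately show ?case using assms(2,3) Cons p by (cases e) auto
  qed
  then show ?thesis by (metis Quotient_braid3 Quotient_abs_rep)
qed

lemma Delta2_sigma: "sigma c * Delta ^ (2 * n) = Delta ^ (2 * n) * sigma c"
proof (induction n)
  case (Suc n)
  have "sigma c * (Delta * Delta) = Delta * Delta * sigma c"
    using Delta_sigma[of c] Delta_sigma[of "other c"] by (metis mult.assoc other_other)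
  then have "sigma c * (Delta * Delta) * Delta ^ (2 * n) = Delta * Delta * (sigma c * Delta ^ (2 * n))"
    by (simp add: mult.assoc)
  then show ?case using Suc by (simp add: mult.assoc)
qed simp

lemma Delta2_central: "g * Delta ^ (2 * n) = Delta ^ (2 * n) * g"
proof (induction g rule: braid3_induct)
  case (sigma c g)
  then show ?case using Delta2_sigma by (metis mult.assoc)
next
  case (inverse_sigma c g)
  have "sigma c * (inverse (sigma c) * g * Delta ^ (2 * n)) = Delta ^ (2 * n) * g"
    using inverse_sigma by (simp add: mult.assoc)
  also have "\<dots> = Delta ^ (2 * n) * sigma c * (inverse (sigma c) * g)"
    by (simp add: mult.assoc)
  also have "\<dots> = sigma c * (Delta ^ (2 * n) * (inverse (sigma c) * g))"
    by (simp only: Delta2_sigma[symmetric] mult.assoc)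
  finally have "sigma c * (inverse (sigma c) * g * Delta ^ (2 * n)) =
      sigma c * (Delta ^ (2 * n) * (inverse (sigma c) * g))" .
  then show ?case by (simp only: braid3.left_cancel)
qed simp

text \<open>
  Inverses of generators are removed by \<open>c\<^sup>-\<^sup>1 \<Delta> = c' c\<close>, with \<open>c'\<close> the other generator.  Even
  powers of \<open>\<Delta>\<close> are used because they are central.
\<close>

lemma positive_multiple: "\<exists>G n. g * Delta ^ (2 * n) = braid_of G"
proof (induction g rule: braid3_induct)
  case one
  show ?case by (intro exI[of _ "[]"] exI[of _ 0]) simp
next
  case (sigma c g)
  then obtain G n where "g * Delta ^ (2 * n) = braid_of G" by blast
  then show ?case by (intro exI[of _ "c # G"] exI[of _ n]) (simp add: mult.assoc)
next
  case (inverse_sigma c g)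
  then obtain G n where G: "g * Delta ^ (2 * n) = braid_of G" by blast
  have "inverse (sigma c) * Delta * Delta = braid_of ([other c, c] @ [S1, S2, S1])"
    by (subst Delta_eq[of c]) (simp add: Delta_def mult.assoc)
  moreover have "inverse (sigma c) * g * Delta ^ (2 * Suc n)
      = inverse (sigma c) * Delta * Delta * (g * Delta ^ (2 * n))"
  proof -
    have "g * Delta ^ (2 * Suc n) = Delta ^ (2 * Suc n) * g" by (rule Delta2_central)
    also have "\<dots> = Delta * Delta * (Delta ^ (2 * n) * g)" by (simp add: mult.assoc)
    also have "Delta ^ (2 * n) * g = g * Delta ^ (2 * n)" by (rule Delta2_central[symmetric])
    finally show ?thesis by (simp only: mult.assoc)
  qed
  ultimately have "inverse (sigma c) * g * Delta ^ (2 * Suc n) = braid_of (([other c, c] @ [S1, S2, S1]) @ G)"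
    using G by (simp add: mult.assoc)
  then show ?case by blast
qed

lemma conjby_Delta2: "conjby (Delta ^ (2 * n)) x = x"
  by (rule conjby_eqI) (rule Delta2_central[symmetric])

text \<open>
  The conjugating braid need not be positive, but a positive \<open>G\<close> that differs from it by a central
  factor conjugates in the same way.  A positive multiple \<open>H\<close> of the inverse then makes the
  remainder \<open>G H\<close> central, so that such words can be concatenated without disturbing one
  another's entries.
\<close>

lemma selection_of_conjugate:
  assumes "conjugate X (sigma S1)"
  shows "\<exists>m n. selection 1 m = [X] \<and> braid_of (rest m) = Delta ^ (2 * n)"
proof -
  obtain g where X: "X = conjby g (sigma S1)"
    using assms by (auto simp: conjugate_def conjby_def)
  obtain G n where G: "g * Delta ^ (2 * n) = braid_of G" using positive_multiple by blast
  obtain H k where H: "inverse g * Delta ^ (2 * k) = braid_of H" using positive_multiple by blast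
  let ?m = "unselected G @ [(S1, True)] @ unselected H"
  have "selection 1 ?m = [conjby (braid_of G) (sigma S1)]"
    by (simp add: selection_append selection_unselected)
  also have "conjby (braid_of G) (sigma S1) = X"
    by (simp add: X conjby_Delta2 flip: G conjby_conjby)
  finally have "selection 1 ?m = [X]" .
  moreover have "braid_of (rest ?m) = g * Delta ^ (2 * n) * inverse g * Delta ^ (2 * k)"
    by (simp add: mult.assoc H flip: G)
  then have "braid_of (rest ?m) = Delta ^ (2 * n) * (g * inverse g) * Delta ^ (2 * k)"
    by (simp only: Delta2_central[of g] mult.assoc)
  then have "braid_of (rest ?m) = Delta ^ (2 * (n + k))"
    by (simp add: add_mult_distrib2 power_add)
  ultimately show ?thesis by blast
qed

lemma selection_of_conjugates:
  assumes "\<forall>X \<in> set T. conjugate X (sigma S1)"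
  shows "\<exists>m n. selection 1 m = T \<and> braid_of (rest m) = Delta ^ (2 * n)"
  using assms
proof (induction T)
  case Nil
  show ?case by (intro exI[of _ "[]"] exI[of _ 0]) simp
next
  case (Cons X T)
  then obtain m n where m: "selection 1 m = T" "braid_of (rest m) = Delta ^ (2 * n)" by auto
  obtain m' k where m': "selection 1 m' = [X]" "braid_of (rest m') = Delta ^ (2 * k)"
    using selection_of_conjugate[of X] Cons.prems by force
  have "selection (Delta ^ (2 * k)) m = T"
    using selection_conjby[of "Delta ^ (2 * k)" 1 m] m(1) by (simp add: conjby_Delta2[abs_def])
  then have "selection 1 (m' @ m) = X # T"
    using m' by (simp add: selection_append)
  moreover have "braid_of (rest (m' @ m)) = Delta ^ (2 * (k + n))"
    using m(2) m'(2) by (simp add: add_mult_distrib2 power_add)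
  ultimately show ?case by blast
qed

lemma prod_list_selection:
  "prod_list (selection g m) * (g * braid_of (rest m)) = g * braid_of (map fst m)"
proof (induction g m rule: selection.induct)
  case (2 g x m)
  then show ?case by (simp add: mult.assoc) (simp add: conjby_def mult.assoc)
qed (simp_all add: mult.assoc)

text \<open>
  The word built from the entries of \<open>T\<close>, followed by an unselected \<open>\<Delta>\<^sup>p\<close>, represents
  \<open>W \<Delta>\<^sup>2\<^sup>n\<close> and has the remainder \<open>\<Delta>\<^sup>2\<^sup>n\<^sup>+\<^sup>p\<close>.
\<close>

lemma realizes_factorization:
  assumes "qp_factorization (braid_of W * inverse (Delta ^ p)) T"
  shows "realizes p W T"
proof -
  obtain m n where m: "selection 1 m = T" "braid_of (rest m) = Delta ^ (2 * n)"
    using selection_of_conjugates assms unfolding qp_factorization_def by blast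
  let ?m = "m @ unselected (delta_power p)"
  have rest: "braid_of (rest ?m) = Delta ^ (2 * n + p)"
    using m(2) by (simp add: braid_of_delta_power power_add)
  moreover have "selection 1 ?m = T"
    using m(1) by (simp add: selection_append selection_unselected)
  ultimately have "realizes (2 * n + p) (map fst ?m) T"
    unfolding realizes_def by (intro exI[of _ ?m]) (simp del: map_append)
  moreover have "braid_of (map fst ?m) = prod_list T * Delta ^ (2 * n + p)"
    using prod_list_selection[of 1 ?m] rest \<open>selection 1 ?m = T\<close>
    by (simp del: map_append filter_append)
  then have "braid_of (map fst ?m) = braid_of (W @ delta_power (2 * n))"
    using assms by (simp add: qp_factorization_def braid_of_delta_power power_add mult.assoc add.commute)
  ultimately have "realizes (2 * n + p) (W @ delta_power (2 * n)) T"
    using realizes_braid_eq by blast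
  then show ?thesis by (rule realizes_cancel_delta_power)
qed

section \<open>Minimal index sets\<close>

definition marked :: "gen list \<Rightarrow> nat set \<Rightarrow> (gen \<times> bool) list" where
  "marked W I = map (\<lambda>i. (letter W i, i \<in> I)) [1..<length W + 1]"

lemma marked_surj:
  assumes "map fst m = W"
  shows "\<exists>I. I \<subseteq> {1..length W} \<and> marked W I = m"
proof -
  have len: "length m = length W" using assms by auto
  have "marked W {i \<in> {1..length W}. snd (m ! (i - 1))} = m"
  proof (rule nth_equalityI)
    fix i
    assume "i < length (marked W {i \<in> {1..length W}. snd (m ! (i - 1))})"
    then have i: "i < length W" by (simp add: marked_def del: upt_Suc)
    then have "W ! i = fst (m ! i)" using len assms by (metis nth_map)
    then show "marked W {i \<in> {1..length W}. snd (m ! (i - 1))} ! i = m ! i"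
      using i by (simp add: marked_def letter_def prod_eq_iff del: upt_Suc)
  qed (simp add: marked_def len del: upt_Suc)
  then show ?thesis by (intro exI[of _ "{i \<in> {1..length W}. snd (m ! (i - 1))}"]) auto
qed

text \<open>
  A violation of minimality at \<open>i\<close> is repaired by selecting the letter \<open>i - 1\<close> instead: two equal
  neighbouring letters commute, so neither the tuple nor the remainder changes.
\<close>

lemma marked_shift:
  assumes I: "I \<subseteq> {1..length W}" and i: "i - 1 \<ge> 1" "i - 1 \<notin> I" "i \<in> I"
    and eq: "letter W (i - 1) = letter W i"
  defines "I' \<equiv> insert (i - 1) (I - {i})"
  shows "I' \<subseteq> {1..length W}" "\<Sum>I' < \<Sum>I"
    "selection 1 (marked W I) \<approx> selection 1 (marked W I')"
    "braid_of (rest (marked W I)) = braid_of (rest (marked W I'))"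
proof -
  have i': "2 \<le> i" "i \<le> length W" "finite I" using I i finite_subset[OF I] by auto
  show "I' \<subseteq> {1..length W}" using I i(1) i'(2) by (auto simp: I'_def)
  have "\<Sum>I = i + \<Sum>(I - {i})" using i' i(3) by (simp add: sum.remove)
  moreover have "\<Sum>I' = (i - 1) + \<Sum>(I - {i})"
    unfolding I'_def using i' i(2) by (subst sum.insert) auto
  ultimately show "\<Sum>I' < \<Sum>I" using i' by simp
  have "[1..<length W + 1] = [1..<i - 1] @ [i - 1..<length W + 1]"
    using upt_add_eq_append[of 1 "i - 1" "length W + 2 - i"] i' by simp
  also have "[i - 1..<length W + 1] = [i - 1, i] @ [i + 1..<length W + 1]"
    using i' by (simp add: upt_conv_Cons)
  finally have split: "[1..<length W + 1] = [1..<i - 1] @ [i - 1, i] @ [i + 1..<length W + 1]" .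
  let ?f = "\<lambda>I i. (letter W i, i \<in> I)"
  define a where "a = letter W i"
  have 1: "marked W I = map (?f I) [1..<i - 1] @ [(a, False), (a, True)] @ map (?f I) [i + 1..<length W + 1]"
    unfolding marked_def split using i eq by (simp add: a_def)
  have 2: "marked W I' = map (?f I) [1..<i - 1] @ [(a, True), (a, False)] @ map (?f I) [i + 1..<length W + 1]"
    unfolding marked_def split using i' eq by (auto simp: I'_def a_def)
  show "selection 1 (marked W I) \<approx> selection 1 (marked W I')"
    "braid_of (rest (marked W I)) = braid_of (rest (marked W I'))"
    unfolding 1 2 by (rule replace_factor; simp)+
qed

lemma selection_map:
  "selection 1 (map (\<lambda>i. (letter W i, i \<in> I)) [1..<n + 1]) =
   map (\<lambda>i. conjby (braid_of (map (letter W) (filter (\<lambda>j. j \<notin> I) [1..<i]))) (sigma (letter W i)))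
     (filter (\<lambda>i. i \<in> I) [1..<n + 1])"
proof (induction n)
  case (Suc n)
  have "rest (map (\<lambda>i. (letter W i, i \<in> I)) l) = map (letter W) (filter (\<lambda>j. j \<notin> I) l)" for l
    by (induction l) auto
  then show ?case using Suc by (cases "Suc n \<in> I") (simp_all add: selection_append)
qed simp

lemma sorted_list_of_set_filter:
  assumes "I \<subseteq> {1..n}"
  shows "sorted_list_of_set I = filter (\<lambda>i. i \<in> I) [1..<n + 1]"
proof -
  have "I = set (filter (\<lambda>i. i \<in> I) [1..<n + 1])" using assms by auto
  then show ?thesis
    by (metis distinct_filter distinct_upt sorted_list_of_set.idem_if_sorted_distinct sorted_upt sorted_wrt_filter)
qed

text \<open>
  This replaces the description of \<open>A\<^sub>j\<close> by consecutive gaps with the one that \<open>selection\<close>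
  follows.
\<close>

lemma gaps_upto_filter:
  assumes "I \<subseteq> {1..length W}" "1 \<le> j" "j \<le> card I"
  shows "gaps_upto W I j = map (letter W) (filter (\<lambda>i. i \<notin> I) [1..<cut W I j])"
  using assms(2,3)
proof (induction j)
  case (Suc j)
  let ?l = "sorted_list_of_set I"
  have fin: "finite I" using assms(1) finite_subset by blast
  have sorted: "sorted_wrt (<) ?l" and len: "length ?l = card I" and set: "set ?l = I"
    using fin by simp_all
  have cut: "cut W I (Suc i) = ?l ! i" if "i < card I" for i
    using that len by (simp add: cut_def nth_append)
  have gap: "gap W I (Suc j) = map (letter W) (filter (\<lambda>i. i \<notin> I) [cut W I j + 1..<cut W I (Suc j)])"
  proof -
    have "i \<notin> I" if "cut W I j + 1 \<le> i" "i < cut W I (Suc j)" for i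
    proof
      assume "i \<in> I"
      then obtain k where k: "k < card I" "i = ?l ! k" using set len by (metis in_set_conv_nth)
      have "i < ?l ! j" using that(2) cut Suc.prems by simp
      then have "k < j"
        using k sorted_wrt_nth_less[OF sorted, of j k] len by (metis less_asym linorder_neqE_nat)
      then obtain j' where j': "j = Suc j'" by (cases j) auto
      then have "?l ! k \<le> ?l ! j'" "cut W I j = ?l ! j'"
        using \<open>k < j\<close> cut[of j'] Suc.prems sorted_wrt_nth_less[OF sorted, of k j'] len
        by (cases "k = j'"; force)+
      then show False using that(1) k by simp
    qed
    then have "filter (\<lambda>i. i \<notin> I) [cut W I j + 1..<cut W I (Suc j)] = [cut W I j + 1..<cut W I (Suc j)]"
      by (auto intro!: filter_True)
    then show ?thesis by (simp add: gap_def)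
  qed
  show ?case
  proof (cases "j = 0")
    case True
    then show ?thesis using gap by (simp add: gaps_upto_def cut_def)
  next
    case False
    then obtain j' where j': "j = Suc j'" by (cases j) auto
    have "cut W I j \<in> I" using cut[of j'] j' Suc.prems len set by (metis Suc_leD Suc_le_lessD nth_mem)
    moreover have "cut W I j < cut W I (Suc j)"
      using cut[of j'] cut[of j] j' Suc.prems sorted_wrt_nth_less[OF sorted, of j' j] len by simp
    moreover have "1 \<le> cut W I j" using \<open>cut W I j \<in> I\<close> assms(1) by auto
    ultimately have "filter (\<lambda>i. i \<notin> I) [1..<cut W I (Suc j)] =
        filter (\<lambda>i. i \<notin> I) [1..<cut W I j] @ filter (\<lambda>i. i \<notin> I) [cut W I j + 1..<cut W I (Suc j)]"
      using upt_add_eq_append[of 1 "cut W I j" "cut W I (Suc j) - cut W I j"]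
        upt_conv_Cons[of "cut W I j" "cut W I (Suc j)"] by simp
    moreover have "gaps_upto W I (Suc j) = gaps_upto W I j @ gap W I (Suc j)"
      by (simp add: gaps_upto_def)
    ultimately show ?thesis using Suc gap False by simp
  qed
qed simp

lemma word_tuple_marked:
  assumes "I \<subseteq> {1..length W}"
  shows "word_tuple W I = selection 1 (marked W I)"
proof -
  let ?l = "sorted_list_of_set I"
  let ?F = "\<lambda>i. conjby (braid_of (map (letter W) (filter (\<lambda>j. j \<notin> I) [1..<i]))) (sigma (letter W i))"
  have len: "length ?l = card I" by simp
  have "word_tuple W I = map (\<lambda>j. ?F (cut W I j)) [1..<card I + 1]"
    unfolding word_tuple_def
  proof (intro map_cong refl)
    fix j
    assume "j \<in> set [1..<card I + 1]"
    then have "1 \<le> j" "j \<le> card I" by auto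
    from gaps_upto_filter[OF assms this]
    show "braid_of (gaps_upto W I j) * sigma (letter W (cut W I j)) *
        inverse (braid_of (gaps_upto W I j)) = ?F (cut W I j)"
      by (simp only: conjby_def)
  qed
  also have "\<dots> = map ?F (map (cut W I) [1..<card I + 1])" by simp
  also have "map (cut W I) [1..<card I + 1] = ?l"
    using len by (intro nth_equalityI) (simp_all add: cut_def nth_append del: upt_Suc)
  finally show ?thesis
    using sorted_list_of_set_filter[OF assms] selection_map[of W I "length W"]
    by (simp add: marked_def)
qed

theorem theorem1:
  fixes W :: "gen list" and p :: nat and X :: braid3
  assumes "X = braid_of W * inverse (Delta ^ p)"
    and "quasipositive X"
  shows "\<forall>Omega \<in> {hurwitz_orbit Xs | Xs. qp_factorization X Xs}.
           \<exists>I. I \<subseteq> {1..length W} \<and> minimal W I \<and> word_tuple W I \<in> Omega"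
proof -
  have "\<exists>I. I \<subseteq> {1..length W} \<and> minimal W I \<and> word_tuple W I \<in> hurwitz_orbit T"
    if T: "qp_factorization X T" for T
  proof -
    define good where "good I \<longleftrightarrow> I \<subseteq> {1..length W} \<and>
      selection 1 (marked W I) \<approx> T" for I
    obtain m where "map fst m = W" "selection 1 m \<approx> T"
      using realizes_factorization T assms(1) unfolding realizes_def by blast
    then have "\<exists>I. good I"
      using marked_surj unfolding good_def by metis
    then obtain I where I: "good I" and least: "\<And>I'. good I' \<Longrightarrow> \<Sum>I \<le> \<Sum>I'"
      using ex_has_least_nat[of good _ "\<lambda>I. \<Sum>I"] by blast
    have "minimal W I"
      unfolding minimal_def
    proof
      assume "\<exists>i. i - 1 \<ge> 1 \<and> i - 1 \<notin> I \<and> i \<in> I \<and> letter W (i - 1) = letter W i"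
      then obtain i where i: "i - 1 \<ge> 1" "i - 1 \<notin> I" "i \<in> I" "letter W (i - 1) = letter W i" by blast
      have "I \<subseteq> {1..length W}" using I by (simp add: good_def)
      note shift = marked_shift[OF this i]
      have "good (insert (i - 1) (I - {i}))"
        using I shift(1,3) unfolding good_def by (meson hurwitz_eq_sym hurwitz_eq_trans)
      then show False using least shift(2) by (simp add: leD)
    qed
    moreover have "word_tuple W I \<in> hurwitz_orbit T"
      using I hurwitz_eq_orbit[OF hurwitz_eq_sym] by (simp add: good_def word_tuple_marked)
    ultimately show ?thesis using I unfolding good_def by blast
  qed
  then show ?thesis by blast
qed

end
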